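(* Let $H$ be a finite-dimensional flip-Hopf $*$-algebra over $\mathbb C$ with right-invariant integral $\int:H\to\mathbb C$ and left integral element $\Lambda\in H$, normalised so that $\int\Lambda=1$. Suppose that $\int h^*=\overline{\int h}$ for all $h\in H$ and that $\Lambda^*=\Lambda$. Then both of the F-algebras $(\mu_r,1_r,\Delta_r,\epsilon_r)$ and $(\mu_g,1_g,\Delta_g,\epsilon_g)$ of the F-Hopf algebra induced by $H$ are F-$*$-algebras (with the given $*$), and the associated Hopf algebra $\tilde H=(\mu_g,1_g,\Delta_r,\epsilon_r)$ is also a flip-Hopf $*$-algebra (with the given $*$).
   Context: A flip-Hopf $*$-algebra is a Hopf algebra over $\mathbb C$ whose algebra is a $*$-algebra (antilinear anti-algebra involution $*$) such that $\Delta\circ*=\dagger\circ\Delta$, $\overline{\epsilon(h)}=\epsilon(h^* )$ and $S\circ*=*\circ S$, where $\dagger=\mathrm{flip}\circ( *\otimes* )$. Write $(\mu_r,1_r,\Delta_g,\epsilon_g,S)$ for the Hopf algebra structure of $H$, $\mu_r$ by juxtaposition, $\Delta_gh=h_1\otimes h_2$. Right-invariant integral: $(\int\otimes\mathrm{id})\Delta_g=1_r\int$. Left integral element: $h\Lambda=\epsilon_g(h)\Lambda$. The induced F-Hopf algebra is obtained as follows. The algebra of $H$ is Frobenius with $(h,h')_r=\int hh'$ and inverse metric $g_r=\Lambda_1\otimes S\Lambda_2$; this defines $\Delta_rh=\Lambda_1\otimes(S\Lambda_2)h$ and $\epsilon_r(h)=\int h$. The coalgebra of $H$ is Frobenius with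 $(h,h')_g=\int(Sh)h'$ and $g_g=\Delta_g\Lambda$; this defines $\mu_g(h\otimes h')=h_1\int(Sh_2)h'$ and $1_g=\Lambda$. It is known that $(\mu_r,1_r,\Delta_r,\epsilon_r)$ and $(\mu_g,1_g,\Delta_g,\epsilon_g)$ are F-algebras and that $\tilde H=(\mu_g,1_g,\Delta_r,\epsilon_r)$ is a Hopf algebra. An F-algebra is an algebra $(\mu,1)$ and coalgebra $(\Delta,\epsilon)$ on the same space with $(\mathrm{id}\otimes\mu)(\Delta\otimes\mathrm{id})=\Delta\mu=(\mu\otimes\mathrm{id})(\mathrm{id}\otimes\Delta)$; it corresponds to a Frobenius algebra with form $(\ ,\ )=\epsilon\mu$ and metric $g=\Delta(1)$. An F-$*$-algebra is an F-algebra over $\mathbb C$ with an antilinear involution $*$ such that the algebra is a $*$-algebra, $\overline{(a,b)}=(b^*,a^* )$ for all $a,b$ (equivalently $g^\dagger=g$), and $\Delta\circ*=\dagger\circ\Delta$, $\overline{\epsilon(a)}=\epsilon(a^* )$. *)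

theory Defs
  imports Complex_Main "HOL-Library.Poly_Mapping"
begin

section \<open>Complex vector spaces\<close>

class scaleC =
  fixes scaleC :: "complex \<Rightarrow> 'a \<Rightarrow> 'a"  (infixr \<open>*\<^sub>C\<close> 75)

class complex_vector = scaleC + ab_group_add +
  assumes scaleC_add_right: "a *\<^sub>C (x + y) = a *\<^sub>C x + a *\<^sub>C y"
    and scaleC_add_left: "(a + b) *\<^sub>C x = a *\<^sub>C x + b *\<^sub>C x"
    and scaleC_scaleC: "a *\<^sub>C b *\<^sub>C x = (a * b) *\<^sub>C x"
    and scaleC_one: "1 *\<^sub>C x = x"

global_interpretation complex_vector: vector_space "scaleC :: complex \<Rightarrow> 'a \<Rightarrow> 'a::complex_vector"
  by unfold_locales (rule scaleC_add_right scaleC_add_left scaleC_scaleC scaleC_one)+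

instantiation complex :: complex_vector
begin
definition "a *\<^sub>C (x::complex) = a * x"
instance by standard (simp_all add: scaleC_complex_def algebra_simps)
end

instantiation poly_mapping :: (type, complex_vector) complex_vector
begin
lift_definition scaleC_poly_mapping :: "complex \<Rightarrow> ('a \<Rightarrow>\<^sub>0 'b) \<Rightarrow> 'a \<Rightarrow>\<^sub>0 'b"
  is "\<lambda>c f k. c *\<^sub>C f k"
  by (erule finite_subset[rotated]) auto
instance
  by standard (transfer; simp add: fun_eq_iff complex_vector.scale_right_distrib
    complex_vector.scale_left_distrib)+
end

abbreviation clinear :: "('a::complex_vector \<Rightarrow> 'b::complex_vector) \<Rightarrow> bool"
  where "clinear \<equiv> Vector_Spaces.linear scaleC scaleC"

definition cbilinear :: "('a::complex_vector \<Rightarrow> 'b::complex_vector \<Rightarrow> 'c::complex_vector) \<Rightarrow> bool"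
  where "cbilinear f \<longleftrightarrow> (\<forall>a. clinear (f a)) \<and> (\<forall>b. clinear (\<lambda>a. f a b))"

definition antilinear :: "('a::complex_vector \<Rightarrow> 'b::complex_vector) \<Rightarrow> bool"
  where "antilinear f \<longleftrightarrow> (\<forall>x y. f (x + y) = f x + f y) \<and> (\<forall>c x. f (c *\<^sub>C x) = cnj c *\<^sub>C f x)"

lemma clinear_iff:
  "clinear f \<longleftrightarrow> (\<forall>x y. f (x + y) = f x + f y) \<and> (\<forall>c x. f (c *\<^sub>C x) = c *\<^sub>C f x)"
  by (auto simp: Vector_Spaces.linear_iff complex_vector.vector_space_axioms)


section \<open>The algebraic tensor product over the complex numbers\<close>

text \<open>The free vector space on pairs, modulo the span of the bilinearity relations.\<close>

definition tensor_relations :: "('a::complex_vector \<times> 'b::complex_vector \<Rightarrow>\<^sub>0 complex) set"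
  where "tensor_relations =
    {Poly_Mapping.single (a + a', b) 1 - Poly_Mapping.single (a, b) 1 - Poly_Mapping.single (a', b) 1 | a a' b. True} \<union>
    {Poly_Mapping.single (a, b + b') 1 - Poly_Mapping.single (a, b) 1 - Poly_Mapping.single (a, b') 1 | a b b'. True} \<union>
    {Poly_Mapping.single (c *\<^sub>C a, b) 1 - Poly_Mapping.single (a, b) c | c a b. True} \<union>
    {Poly_Mapping.single (a, c *\<^sub>C b) 1 - Poly_Mapping.single (a, b) c | c a b. True}"

quotient_type (overloaded) ('a, 'b) tensor = "('a::complex_vector \<times> 'b::complex_vector) \<Rightarrow>\<^sub>0 complex"
  / "\<lambda>p q. p - q \<in> complex_vector.span tensor_relations"
proof (rule equivpI)
  let ?R = "complex_vector.span (tensor_relations :: ('a \<times> 'b \<Rightarrow>\<^sub>0 complex) set)"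
  show "reflp (\<lambda>p q. p - q \<in> ?R)"
    by (simp add: reflp_def complex_vector.span_zero)
  show "symp (\<lambda>p q. p - q \<in> ?R)"
  proof (rule sympI)
    fix p q assume "p - q \<in> ?R"
    from complex_vector.span_neg[OF this] show "q - p \<in> ?R" by simp
  qed
  show "transp (\<lambda>p q. p - q \<in> ?R)"
  proof (rule transpI)
    fix p q r assume "p - q \<in> ?R" "q - r \<in> ?R"
    from complex_vector.span_add[OF this] show "p - r \<in> ?R" by simp
  qed
qed

instantiation tensor :: (complex_vector, complex_vector) complex_vector
begin
lift_definition zero_tensor :: "('a, 'b) tensor" is 0 .
lift_definition plus_tensor :: "('a, 'b) tensor \<Rightarrow> ('a, 'b) tensor \<Rightarrow> ('a, 'b) tensor" is "(+)"
  unfolding add_diff_add by (rule complex_vector.span_add)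
lift_definition minus_tensor :: "('a, 'b) tensor \<Rightarrow> ('a, 'b) tensor \<Rightarrow> ('a, 'b) tensor" is "(-)"
  subgoal for p p' q q'
    using complex_vector.span_diff[of "p - p'" tensor_relations "q - q'"] by (simp add: algebra_simps)
  done
lift_definition uminus_tensor :: "('a, 'b) tensor \<Rightarrow> ('a, 'b) tensor" is uminus
  unfolding minus_diff_minus by (rule complex_vector.span_neg)
lift_definition scaleC_tensor :: "complex \<Rightarrow> ('a, 'b) tensor \<Rightarrow> ('a, 'b) tensor" is scaleC
  unfolding complex_vector.scale_right_diff_distrib[symmetric] by (rule complex_vector.span_scale)
instance
  by standard (transfer; simp add: algebra_simps complex_vector.span_zero
    complex_vector.scale_right_distrib complex_vector.scale_left_distrib)+
end

lift_definition pure_tensor :: "'a::complex_vector \<Rightarrow> 'b::complex_vector \<Rightarrow> ('a, 'b) tensor"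
    (infixr \<open>\<otimes>\<^sub>t\<close> 76)
  is "\<lambda>a b. Poly_Mapping.single (a, b) 1" .

lemma pure_tensor_add_left: "(a + a') \<otimes>\<^sub>t b = a \<otimes>\<^sub>t b + a' \<otimes>\<^sub>t b"
  by transfer (rule complex_vector.span_base, unfold diff_diff_eq[symmetric] tensor_relations_def, blast)

lemma pure_tensor_add_right: "a \<otimes>\<^sub>t (b + b') = a \<otimes>\<^sub>t b + a \<otimes>\<^sub>t b'"
  by transfer (rule complex_vector.span_base, unfold diff_diff_eq[symmetric] tensor_relations_def, blast)

lemma scaleC_single: "c *\<^sub>C Poly_Mapping.single k d = Poly_Mapping.single k (c *\<^sub>C d)"
  by transfer (auto simp: when_def)

lemma pure_tensor_scaleC_left: "(c *\<^sub>C a) \<otimes>\<^sub>t b = c *\<^sub>C (a \<otimes>\<^sub>t b)"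
  by transfer (rule complex_vector.span_base,
      unfold scaleC_single scaleC_complex_def mult_1_right tensor_relations_def, blast)

lemma pure_tensor_scaleC_right: "a \<otimes>\<^sub>t (c *\<^sub>C b) = c *\<^sub>C (a \<otimes>\<^sub>t b)"
  by transfer (rule complex_vector.span_base,
      unfold scaleC_single scaleC_complex_def mult_1_right tensor_relations_def, blast)

lemma tensor_induct [case_names zero pure add scale]:
  assumes "P 0" and "\<And>a b. P (a \<otimes>\<^sub>t b)"
    and "\<And>s t. P s \<Longrightarrow> P t \<Longrightarrow> P (s + t)" and "\<And>c t. P t \<Longrightarrow> P (c *\<^sub>C t)"
  shows "P t"
proof -
  have "P (abs_tensor p)" for p :: "'a \<times> 'b \<Rightarrow>\<^sub>0 complex"
  proof (induction p rule: update_induct)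
    case const
    then show ?case using assms(1) by (simp add: zero_tensor_def)
  next
    case (update f k c)
    have eq: "Poly_Mapping.update k c f = f + c *\<^sub>C Poly_Mapping.single k 1"
      using update(1) unfolding scaleC_single scaleC_complex_def mult_1_right
      by (intro poly_mapping_eqI)
        (auto simp: lookup_update lookup_add lookup_single when_def in_keys_iff)
    have "abs_tensor (Poly_Mapping.single k 1) = fst k \<otimes>\<^sub>t snd k"
      by (simp add: pure_tensor.abs_eq)
    then have "P (c *\<^sub>C abs_tensor (Poly_Mapping.single k 1))"
      using assms(2,4) by simp
    with update(3) show ?case
      unfolding eq plus_tensor.abs_eq[symmetric] scaleC_tensor.abs_eq[symmetric]
      by (rule assms(3))
  qed
  then show ?thesis by (rule tensor.abs_induct)
qed

text \<open>The extension property is shown for linear and antilinear maps at once; \<open>\<sigma>\<close> is the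
  identity or complex conjugation.\<close>

lemma tensor_semilinear_extension:
  fixes f :: "'a::complex_vector \<Rightarrow> 'b::complex_vector \<Rightarrow> 'c::complex_vector"
  assumes \<sigma>: "\<And>c d. \<sigma> (c + d) = \<sigma> c + \<sigma> d" "\<And>c d. \<sigma> (c * d) = \<sigma> c * \<sigma> d" "\<sigma> 0 = 0" "\<sigma> 1 = 1"
    and f: "\<And>a a' b. f (a + a') b = f a b + f a' b" "\<And>a b b'. f a (b + b') = f a b + f a b'"
      "\<And>c a b. f (c *\<^sub>C a) b = \<sigma> c *\<^sub>C f a b" "\<And>c a b. f a (c *\<^sub>C b) = \<sigma> c *\<^sub>C f a b"
  shows "\<exists>!F. (\<forall>s t. F (s + t) = F s + F t) \<and> (\<forall>c t. F (c *\<^sub>C t) = \<sigma> c *\<^sub>C F t) \<and>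
    (\<forall>a b. F (a \<otimes>\<^sub>t b) = f a b)"
proof (rule ex_ex1I)
  define E where "E p = (\<Sum>k\<in>Poly_Mapping.keys p. \<sigma> (Poly_Mapping.lookup p k) *\<^sub>C f (fst k) (snd k))" for p
  have E_on: "E p = (\<Sum>k\<in>K. \<sigma> (Poly_Mapping.lookup p k) *\<^sub>C f (fst k) (snd k))"
    if "finite K" "Poly_Mapping.keys p \<subseteq> K" for p K
    unfolding E_def using that
    by (intro sum.mono_neutral_left) (auto simp: in_keys_iff \<sigma>)
  have E_add: "E (p + q) = E p + E q" for p q
  proof -
    let ?K = "Poly_Mapping.keys p \<union> Poly_Mapping.keys q"
    have "E p = (\<Sum>k\<in>?K. \<sigma> (Poly_Mapping.lookup p k) *\<^sub>C f (fst k) (snd k))" 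
      "E q = (\<Sum>k\<in>?K. \<sigma> (Poly_Mapping.lookup q k) *\<^sub>C f (fst k) (snd k))"
      "E (p + q) = (\<Sum>k\<in>?K. \<sigma> (Poly_Mapping.lookup (p + q) k) *\<^sub>C f (fst k) (snd k))"
      by (intro E_on; use keys_add[of p q] in auto)+
    then show ?thesis
      by (simp add: lookup_add \<sigma> complex_vector.scale_left_distrib sum.distrib)
  qed
  have E_scale: "E (c *\<^sub>C p) = \<sigma> c *\<^sub>C E p" for c p
  proof -
    have l: "Poly_Mapping.lookup (c *\<^sub>C p) k = c * Poly_Mapping.lookup p k" for k
      by (simp add: scaleC_poly_mapping.rep_eq scaleC_complex_def)
    have "E (c *\<^sub>C p) = (\<Sum>k\<in>Poly_Mapping.keys p. \<sigma> (Poly_Mapping.lookup (c *\<^sub>C p) k) *\<^sub>C f (fst k) (snd k))"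
      by (rule E_on) (auto simp: in_keys_iff l)
    then show ?thesis
      by (simp add: l \<sigma> E_def complex_vector.scale_sum_right)
  qed
  have E_single: "E (Poly_Mapping.single (a, b) c) = \<sigma> c *\<^sub>C f a b" for a b c
    by (simp add: E_def \<sigma>)
  have \<sigma>_m1: "\<sigma> (-1) = -1"
    using \<sigma>(1)[of 1 "-1"] \<sigma>(3,4) by (simp add: eq_neg_iff_add_eq_0 add.commute)
  have E_diff: "E (p - q) = E p - E q" for p q
    using E_add[of p "(-1) *\<^sub>C q"] E_scale[of "-1" q] by (simp add: \<sigma>_m1)
  have ker: "E p = 0" if "p \<in> complex_vector.span tensor_relations" for p
    using that
  proof (induction rule: complex_vector.span_induct_alt)
    case base
    then show ?case by (simp add: E_def)
  next
    case (step c x y)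
    have "E x = 0"
      using step(1) by (auto simp: tensor_relations_def E_diff E_single \<sigma> f)
    with step show ?case by (simp add: E_add E_scale)
  qed
  define F where "F t = E (rep_tensor t)" for t
  have F_abs: "F (abs_tensor p) = E p" for p
  proof -
    have "rep_tensor (abs_tensor p) - p \<in> complex_vector.span tensor_relations"
      using Quotient3_rep_abs[OF Quotient3_tensor, of p] by (simp add: complex_vector.span_zero)
    from ker[OF this] show ?thesis by (simp add: F_def E_diff)
  qed
  have "F (s + t) = F s + F t" for s t
    by (induct s rule: tensor.abs_induct, induct t rule: tensor.abs_induct)
      (simp add: F_abs plus_tensor.abs_eq E_add)
  moreover have "F (c *\<^sub>C t) = \<sigma> c *\<^sub>C F t" for c t
    by (induct t rule: tensor.abs_induct) (simp add: F_abs scaleC_tensor.abs_eq E_scale)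
  moreover have "F (a \<otimes>\<^sub>t b) = f a b" for a b
    by (simp add: pure_tensor.abs_eq F_abs E_single \<sigma>)
  ultimately show "\<exists>F. (\<forall>s t. F (s + t) = F s + F t) \<and> (\<forall>c t. F (c *\<^sub>C t) = \<sigma> c *\<^sub>C F t) \<and>
    (\<forall>a b. F (a \<otimes>\<^sub>t b) = f a b)" by blast
next
  fix F G :: "('a, 'b) tensor \<Rightarrow> 'c"
  assume F: "(\<forall>s t. F (s + t) = F s + F t) \<and> (\<forall>c t. F (c *\<^sub>C t) = \<sigma> c *\<^sub>C F t) \<and>
      (\<forall>a b. F (a \<otimes>\<^sub>t b) = f a b)"
    and G: "(\<forall>s t. G (s + t) = G s + G t) \<and> (\<forall>c t. G (c *\<^sub>C t) = \<sigma> c *\<^sub>C G t) \<and>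
      (\<forall>a b. G (a \<otimes>\<^sub>t b) = f a b)"
  have "F t = G t" for t
  proof (induction t rule: tensor_induct)
    case zero
    have "F 0 + F 0 = F 0" "G 0 + G 0 = G 0" using F G by (metis add.right_neutral)+
    then show ?case by simp
  qed (use F G in auto)
  then show "F = G" by blast
qed

definition tensor_lift ::
    "('a::complex_vector \<Rightarrow> 'b::complex_vector \<Rightarrow> 'c::complex_vector) \<Rightarrow> ('a, 'b) tensor \<Rightarrow> 'c"
  where "tensor_lift f = (THE F. clinear F \<and> (\<forall>a b. F (a \<otimes>\<^sub>t b) = f a b))"

lemma tensor_lift_ex1:
  assumes "cbilinear f"
  shows "\<exists>!F. clinear F \<and> (\<forall>a b. F (a \<otimes>\<^sub>t b) = f a b)"
  using tensor_semilinear_extension[of "\<lambda>c. c" f] assms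
  by (simp add: cbilinear_def clinear_iff conj_assoc)

lemma
  assumes "cbilinear f"
  shows clinear_tensor_lift: "clinear (tensor_lift f)"
    and tensor_lift_pure: "tensor_lift f (a \<otimes>\<^sub>t b) = f a b"
  using theI'[OF tensor_lift_ex1[OF assms]] by (simp_all add: tensor_lift_def)

definition tensor_map :: "('a::complex_vector \<Rightarrow> 'c::complex_vector) \<Rightarrow>
    ('b::complex_vector \<Rightarrow> 'd::complex_vector) \<Rightarrow> ('a, 'b) tensor \<Rightarrow> ('c, 'd) tensor"
  where "tensor_map f g = tensor_lift (\<lambda>a b. f a \<otimes>\<^sub>t g b)"

lemma cbilinear_tensor_map:
  "clinear f \<Longrightarrow> clinear g \<Longrightarrow> cbilinear (\<lambda>a b. f a \<otimes>\<^sub>t g b)"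
  by (simp add: cbilinear_def clinear_iff pure_tensor_add_left pure_tensor_add_right
    pure_tensor_scaleC_left pure_tensor_scaleC_right)

text \<open>The tensor product of two \<^emph>\<open>antilinear\<close> maps is antilinear, so it is not an instance of
  \<open>tensor_map\<close>.\<close>

definition tensor_antimap :: "('a::complex_vector \<Rightarrow> 'c::complex_vector) \<Rightarrow>
    ('b::complex_vector \<Rightarrow> 'd::complex_vector) \<Rightarrow> ('a, 'b) tensor \<Rightarrow> ('c, 'd) tensor"
  where "tensor_antimap f g = (THE F. antilinear F \<and> (\<forall>a b. F (a \<otimes>\<^sub>t b) = f a \<otimes>\<^sub>t g b))"

lemma tensor_antimap_ex1:
  assumes "antilinear f" "antilinear g"
  shows "\<exists>!F. antilinear F \<and> (\<forall>a b. F (a \<otimes>\<^sub>t b) = f a \<otimes>\<^sub>t g b)"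
  using tensor_semilinear_extension[of cnj "\<lambda>a b. f a \<otimes>\<^sub>t g b"] assms
  by (simp add: antilinear_def conj_assoc pure_tensor_add_left pure_tensor_add_right
    pure_tensor_scaleC_left pure_tensor_scaleC_right)

lemma
  assumes "antilinear f" "antilinear g"
  shows antilinear_tensor_antimap: "antilinear (tensor_antimap f g)"
    and tensor_antimap_pure: "tensor_antimap f g (a \<otimes>\<^sub>t b) = f a \<otimes>\<^sub>t g b"
  using theI'[OF tensor_antimap_ex1[OF assms]] by (simp_all add: tensor_antimap_def)

definition tensor_flip :: "('a::complex_vector, 'b::complex_vector) tensor \<Rightarrow> ('b, 'a) tensor"
  where "tensor_flip = tensor_lift (\<lambda>a b. b \<otimes>\<^sub>t a)"

definition tensor_assoc :: "(('a::complex_vector, 'b::complex_vector) tensor, 'c::complex_vector) tensor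
    \<Rightarrow> ('a, ('b, 'c) tensor) tensor"
  where "tensor_assoc = tensor_lift (\<lambda>s c. tensor_lift (\<lambda>a b. a \<otimes>\<^sub>t b \<otimes>\<^sub>t c) s)"

definition tensor_assoc_inv :: "('a::complex_vector, ('b::complex_vector, 'c::complex_vector) tensor) tensor
    \<Rightarrow> (('a, 'b) tensor, 'c) tensor"
  where "tensor_assoc_inv = tensor_lift (\<lambda>a. tensor_lift (\<lambda>b c. (a \<otimes>\<^sub>t b) \<otimes>\<^sub>t c))"

definition tensor_mult :: "('a::complex_vector \<Rightarrow> 'a \<Rightarrow> 'a) \<Rightarrow>
    ('a, 'a) tensor \<Rightarrow> ('a, 'a) tensor \<Rightarrow> ('a, 'a) tensor"
  where "tensor_mult m s t =
    tensor_lift (\<lambda>a b. tensor_lift (\<lambda>c d. m a c \<otimes>\<^sub>t m b d) t) s"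

definition tensor_dagger :: "('a::complex_vector \<Rightarrow> 'a) \<Rightarrow> ('a, 'a) tensor \<Rightarrow> ('a, 'a) tensor"
  where "tensor_dagger st = tensor_flip \<circ> tensor_antimap st st"

lemma cbilinearI: "(\<And>a. clinear (f a)) \<Longrightarrow> (\<And>b. clinear (\<lambda>a. f a b)) \<Longrightarrow> cbilinear f"
  by (simp add: cbilinear_def)

lemma cbilinear_pure_tensor: "cbilinear (\<otimes>\<^sub>t)"
  by (simp add: cbilinear_def clinear_iff pure_tensor_add_left pure_tensor_add_right
    pure_tensor_scaleC_left pure_tensor_scaleC_right)

lemma clinear_tensor_lift_family:
  fixes h :: "'a::complex_vector \<Rightarrow> 'b::complex_vector \<Rightarrow> 'c::complex_vector \<Rightarrow> 'd::complex_vector"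
  assumes "\<And>u. cbilinear (h u)" and "\<And>a b. clinear (\<lambda>u. h u a b)"
  shows "clinear (\<lambda>u. tensor_lift (h u) t)"
proof -
  have h: "h (u + v) a b = h u a b + h v a b" "h (c *\<^sub>C u) a b = c *\<^sub>C h u a b" for u v c a b
    using assms(2) by (auto simp: clinear_iff)
  have l: "tensor_lift g (s + t) = tensor_lift g s + tensor_lift g t"
      "tensor_lift g (c *\<^sub>C s) = c *\<^sub>C tensor_lift g s" "tensor_lift g 0 = 0"
    if "cbilinear g" for g :: "'b \<Rightarrow> 'c \<Rightarrow> 'd" and s t c
  proof -
    show 1: "tensor_lift g (s + t) = tensor_lift g s + tensor_lift g t" for s t
      using clinear_tensor_lift[OF that] by (auto simp: clinear_iff)
    show "tensor_lift g (c *\<^sub>C s) = c *\<^sub>C tensor_lift g s"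
      using clinear_tensor_lift[OF that] by (auto simp: clinear_iff)
    show "tensor_lift g 0 = 0" using 1[of 0 0] by simp
  qed
  have "tensor_lift (h (u + v)) t = tensor_lift (h u) t + tensor_lift (h v) t" for u v
  proof -
    define k where "k = h (u + v)"
    have k: "cbilinear k" by (simp only: k_def assms(1))
    have p: "tensor_lift k (a \<otimes>\<^sub>t b) = h u a b + h v a b" for a b
      by (simp only: tensor_lift_pure[OF k]) (simp only: k_def h)
    show ?thesis unfolding k_def[symmetric]
      by (induction t rule: tensor_induct)
        (simp_all add: l[OF assms(1)] l[OF k] p tensor_lift_pure[OF assms(1)]
          complex_vector.scale_right_distrib)
  qed
  moreover have "tensor_lift (h (c *\<^sub>C u)) t = c *\<^sub>C tensor_lift (h u) t" for c u
  proof -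
    define k where "k = h (c *\<^sub>C u)"
    have k: "cbilinear k" by (simp only: k_def assms(1))
    have p: "tensor_lift k (a \<otimes>\<^sub>t b) = c *\<^sub>C h u a b" for a b
      by (simp only: tensor_lift_pure[OF k]) (simp only: k_def h)
    show ?thesis unfolding k_def[symmetric]
      by (induction t rule: tensor_induct)
        (simp_all add: l[OF assms(1)] l[OF k] p tensor_lift_pure[OF assms(1)]
          complex_vector.scale_right_distrib mult.commute)
  qed
  ultimately show ?thesis by (simp add: clinear_iff)
qed

lemma tensor_flip_pure: "tensor_flip ((a::'a::complex_vector) \<otimes>\<^sub>t (b::'b::complex_vector)) = b \<otimes>\<^sub>t a"
proof -
  have "cbilinear (\<lambda>(a::'a) (b::'b). b \<otimes>\<^sub>t a)"
    using cbilinear_pure_tensor[where 'a = 'b and 'b = 'a] by (auto simp: cbilinear_def)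
  then show ?thesis by (simp add: tensor_flip_def tensor_lift_pure)
qed

lemma tensor_dagger_pure:
  "antilinear st \<Longrightarrow> tensor_dagger st (a \<otimes>\<^sub>t b) = st b \<otimes>\<^sub>t st a"
  by (simp add: tensor_dagger_def tensor_antimap_pure tensor_flip_pure)

lemma tensor_assoc_pure:
  fixes a :: "'a::complex_vector" and b :: "'b::complex_vector" and c :: "'c::complex_vector"
  shows "tensor_assoc ((a \<otimes>\<^sub>t b) \<otimes>\<^sub>t c) = a \<otimes>\<^sub>t b \<otimes>\<^sub>t c"
proof -
  note pt = pure_tensor_add_left pure_tensor_add_right pure_tensor_scaleC_left pure_tensor_scaleC_right
  have 1: "cbilinear (\<lambda>a b. a \<otimes>\<^sub>t b \<otimes>\<^sub>t c)" for c :: 'c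
    by (simp add: cbilinear_def clinear_iff pt)
  have "cbilinear (\<lambda>s (c::'c). tensor_lift (\<lambda>(a::'a) (b::'b). a \<otimes>\<^sub>t b \<otimes>\<^sub>t c) s)"
    by (intro cbilinearI clinear_tensor_lift_family clinear_tensor_lift 1)
      (simp add: clinear_iff pt)
  then show ?thesis
    by (simp add: tensor_assoc_def tensor_lift_pure 1)
qed

lemma tensor_assoc_inv_pure:
  fixes a :: "'a::complex_vector" and b :: "'b::complex_vector" and c :: "'c::complex_vector"
  shows "tensor_assoc_inv (a \<otimes>\<^sub>t b \<otimes>\<^sub>t c) = (a \<otimes>\<^sub>t b) \<otimes>\<^sub>t c"
proof -
  note pt = pure_tensor_add_left pure_tensor_add_right pure_tensor_scaleC_left pure_tensor_scaleC_right
  have 1: "cbilinear (\<lambda>b c. (a \<otimes>\<^sub>t b) \<otimes>\<^sub>t c)" for a :: 'a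
    by (simp add: cbilinear_def clinear_iff pt)
  have "cbilinear (\<lambda>(a::'a). tensor_lift (\<lambda>(b::'b) (c::'c). (a \<otimes>\<^sub>t b) \<otimes>\<^sub>t c))"
    by (intro cbilinearI clinear_tensor_lift_family clinear_tensor_lift 1)
      (simp add: clinear_iff pt)
  then show ?thesis
    by (simp add: tensor_assoc_inv_def tensor_lift_pure 1)
qed

lemma tensor_mult_pure:
  assumes "cbilinear m"
  shows "tensor_mult m (a \<otimes>\<^sub>t b) (c \<otimes>\<^sub>t d) = m a c \<otimes>\<^sub>t m b d"
proof -
  note pt = pure_tensor_add_left pure_tensor_add_right pure_tensor_scaleC_left pure_tensor_scaleC_right
  have 1: "cbilinear (\<lambda>c d. m a c \<otimes>\<^sub>t m b d)" for a b
    using assms by (simp add: cbilinear_def clinear_iff pt)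
  have "cbilinear (\<lambda>a b. tensor_lift (\<lambda>c d. m a c \<otimes>\<^sub>t m b d) t)" for t
    by (intro cbilinearI clinear_tensor_lift_family 1)
      (use assms in \<open>simp_all add: cbilinear_def clinear_iff pt\<close>)
  then show ?thesis
    unfolding tensor_mult_def by (subst tensor_lift_pure) (auto intro: tensor_lift_pure[OF 1])
qed


section \<open>Hopf algebras, F-algebras and their \<open>*\<close>-versions\<close>

text \<open>Several structures live on the same space, so the operations are explicit parameters.
  A product is given as a bilinear map \<open>m\<close>; the linear map on the tensor square is
  \<open>tensor_lift m\<close>.\<close>

locale unital_algebra =
  fixes m :: "'a::complex_vector \<Rightarrow> 'a \<Rightarrow> 'a" and u :: 'a
  assumes bilinear_mult: "cbilinear m"
    and mult_assoc: "m (m a b) c = m a (m b c)"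
    and mult_unit_left: "m u a = a"
    and mult_unit_right: "m a u = a"

locale coalgebra =
  fixes \<Delta> :: "'a::complex_vector \<Rightarrow> ('a, 'a) tensor" and \<epsilon> :: "'a \<Rightarrow> complex"
  assumes linear_comult: "clinear \<Delta>"
    and linear_counit: "clinear \<epsilon>"
    and coassoc: "tensor_assoc (tensor_map \<Delta> id (\<Delta> h)) = tensor_map id \<Delta> (\<Delta> h)"
    and counit_left: "tensor_lift (\<lambda>x y. \<epsilon> x *\<^sub>C y) (\<Delta> h) = h"
    and counit_right: "tensor_lift (\<lambda>x y. \<epsilon> y *\<^sub>C x) (\<Delta> h) = h"

locale bialgebra = unital_algebra m u + coalgebra \<Delta> \<epsilon>
  for m :: "'a::complex_vector \<Rightarrow> 'a \<Rightarrow> 'a" and u and \<Delta> and \<epsilon> +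
  assumes comult_mult: "\<Delta> (m a b) = tensor_mult m (\<Delta> a) (\<Delta> b)"
    and comult_unit: "\<Delta> u = u \<otimes>\<^sub>t u"
    and counit_mult: "\<epsilon> (m a b) = \<epsilon> a * \<epsilon> b"
    and counit_unit: "\<epsilon> u = 1"

locale hopf_algebra = bialgebra m u \<Delta> \<epsilon>
  for m :: "'a::complex_vector \<Rightarrow> 'a \<Rightarrow> 'a" and u and \<Delta> and \<epsilon> +
  fixes S :: "'a \<Rightarrow> 'a"
  assumes linear_antipode: "clinear S"
    and antipode_left: "tensor_lift (\<lambda>x y. m (S x) y) (\<Delta> h) = \<epsilon> h *\<^sub>C u"
    and antipode_right: "tensor_lift (\<lambda>x y. m x (S y)) (\<Delta> h) = \<epsilon> h *\<^sub>C u"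

locale star_algebra = unital_algebra m u
  for m :: "'a::complex_vector \<Rightarrow> 'a \<Rightarrow> 'a" and u +
  fixes st :: "'a \<Rightarrow> 'a"
  assumes antilinear_star: "antilinear st"
    and star_star: "st (st a) = a"
    and star_mult: "st (m a b) = m (st b) (st a)"

locale flip_hopf_star_algebra = hopf_algebra m u \<Delta> \<epsilon> S + star_algebra m u st
  for m :: "'a::complex_vector \<Rightarrow> 'a \<Rightarrow> 'a" and u and \<Delta> and \<epsilon> and S and st +
  assumes comult_star: "\<Delta> (st h) = tensor_dagger st (\<Delta> h)"
    and counit_star: "cnj (\<epsilon> h) = \<epsilon> (st h)"
    and antipode_star: "S (st h) = st (S h)"

text \<open>The two assumptions compare maps on the tensor square, with the associativity isomorphism
  between the two bracketings of the triple tensor product made explicit.\<close>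

locale F_algebra = unital_algebra m u + coalgebra \<Delta> \<epsilon>
  for m :: "'a::complex_vector \<Rightarrow> 'a \<Rightarrow> 'a" and u and \<Delta> and \<epsilon> +
  assumes frobenius_left:
      "tensor_map id (tensor_lift m) (tensor_assoc (tensor_map \<Delta> id t)) = \<Delta> (tensor_lift m t)"
    and frobenius_right:
      "\<Delta> (tensor_lift m t) = tensor_map (tensor_lift m) id (tensor_assoc_inv (tensor_map id \<Delta> t))"

text \<open>The Frobenius form of an F-algebra is \<open>\<epsilon> (m a b)\<close>.\<close>

locale F_star_algebra = F_algebra m u \<Delta> \<epsilon> + star_algebra m u st
  for m :: "'a::complex_vector \<Rightarrow> 'a \<Rightarrow> 'a" and u and \<Delta> and \<epsilon> and st +
  assumes form_star: "cnj (\<epsilon> (m a b)) = \<epsilon> (m (st b) (st a))"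
    and comult_star: "\<Delta> (st a) = tensor_dagger st (\<Delta> a)"
    and counit_star: "cnj (\<epsilon> a) = \<epsilon> (st a)"


section \<open>Integrals and the induced F-Hopf algebra\<close>

definition right_invariant_integral ::
    "'a::complex_vector \<Rightarrow> ('a \<Rightarrow> ('a, 'a) tensor) \<Rightarrow> ('a \<Rightarrow> complex) \<Rightarrow> bool"
  where "right_invariant_integral u \<Delta> I \<longleftrightarrow>
    clinear I \<and> (\<forall>h. tensor_lift (\<lambda>x y. I x *\<^sub>C y) (\<Delta> h) = I h *\<^sub>C u)"

definition left_integral_element ::
    "('a::complex_vector \<Rightarrow> 'a \<Rightarrow> 'a) \<Rightarrow> ('a \<Rightarrow> complex) \<Rightarrow> 'a \<Rightarrow> bool"
  where "left_integral_element m \<epsilon> \<Lambda> \<longleftrightarrow> (\<forall>h. m h \<Lambda> = \<epsilon> h *\<^sub>C \<Lambda>)"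

text \<open>The induced structure consists of the comultiplication and multiplication below, together
  with the counit \<open>\<integral>\<close> and the unit \<open>\<Lambda>\<close>, which need no definitions of their own.\<close>

text \<open>\<open>\<Lambda>\<^sub>1 \<otimes> (S \<Lambda>\<^sub>2) h\<close>\<close>

definition induced_comult :: "('a::complex_vector \<Rightarrow> 'a \<Rightarrow> 'a) \<Rightarrow> ('a \<Rightarrow> ('a, 'a) tensor) \<Rightarrow>
    ('a \<Rightarrow> 'a) \<Rightarrow> 'a \<Rightarrow> 'a \<Rightarrow> ('a, 'a) tensor"
  where "induced_comult m \<Delta> S \<Lambda> h = tensor_map id (\<lambda>x. m (S x) h) (\<Delta> \<Lambda>)"

text \<open>\<open>h\<^sub>1 \<integral> (S h\<^sub>2) h'\<close>\<close>

definition induced_mult :: "('a::complex_vector \<Rightarrow> 'a \<Rightarrow> 'a) \<Rightarrow> ('a \<Rightarrow> ('a, 'a) tensor) \<Rightarrow>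
    ('a \<Rightarrow> 'a) \<Rightarrow> ('a \<Rightarrow> complex) \<Rightarrow> 'a \<Rightarrow> 'a \<Rightarrow> 'a"
  where "induced_mult m \<Delta> S I h h' = tensor_lift (\<lambda>x y. I (m (S y) h') *\<^sub>C x) (\<Delta> h)"

end

theory Submission
  imports Defs
begin

text \<open>
  Applying the involution to the invariance of the integral and of \<open>\<Lambda>\<close> shows that both are
  two-sided. Hence \<open>\<Lambda>\<^sub>1 \<otimes> S \<Lambda>\<^sub>2\<close> and \<open>S \<Lambda>\<^sub>1 \<otimes> \<Lambda>\<^sub>2\<close> are Casimir elements inverse to the form
  \<open>\<integral> h h'\<close> on the right and on the left, so they are equal; dually
  \<open>\<integral> (S h) h' = \<integral> h (S h')\<close>. Every structure map of the induced F-Hopf algebra thus has several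
  expressions, among which the involution permutes, and each axiom is a short Sweedler computation
  once the right expression is chosen. The antipode of the dual is the inverse of \<open>S\<close>, which is
  given explicitly by the integrals.
\<close>

section \<open>Calculus of linear maps on tensor products\<close>

lemma clinear_id: "clinear (\<lambda>x. x)"
  by (simp add: clinear_iff)

lemma clinear_comp: "clinear f \<Longrightarrow> clinear g \<Longrightarrow> clinear (\<lambda>x. f (g x))"
  by (simp add: clinear_iff)

lemma clinear_tensor_lift_arg: "cbilinear f \<Longrightarrow> clinear g \<Longrightarrow> clinear (\<lambda>x. tensor_lift f (g x))"
  using clinear_comp clinear_tensor_lift by blast

lemma clinear_scaleC_left: "clinear g \<Longrightarrow> clinear (\<lambda>x. g x *\<^sub>C v)"
  by (simp add: clinear_iff scaleC_add_left scaleC_scaleC scaleC_complex_def)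

lemma clinear_scaleC_right: "clinear g \<Longrightarrow> clinear (\<lambda>x. c *\<^sub>C g x)"
  by (simp add: clinear_iff scaleC_add_right scaleC_scaleC mult.commute)

lemma clinear_pure_left: "clinear g \<Longrightarrow> clinear (\<lambda>x. g x \<otimes>\<^sub>t b)"
  by (simp add: clinear_iff pure_tensor_add_left pure_tensor_scaleC_left)

lemma clinear_pure_right: "clinear g \<Longrightarrow> clinear (\<lambda>x. a \<otimes>\<^sub>t g x)"
  by (simp add: clinear_iff pure_tensor_add_right pure_tensor_scaleC_right)

lemma clinear_complex_mult:
  "clinear g \<Longrightarrow> clinear (\<lambda>x. c * g x)" "clinear g \<Longrightarrow> clinear (\<lambda>x. g x * c)"
  for c :: complex
  by (simp_all add: clinear_iff scaleC_complex_def algebra_simps)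

text \<open>Given to simp so that the linearity side conditions of the lifting rules are settled
  from the shape of the expression, one variable at a time.\<close>

lemmas tensor_linear = clinear_complex_mult clinear_id clinear_tensor_lift_arg clinear_tensor_lift_family
  clinear_scaleC_left clinear_scaleC_right clinear_pure_left clinear_pure_right cbilinearI

lemma cbilinear_left: "cbilinear f \<Longrightarrow> clinear g \<Longrightarrow> clinear (\<lambda>x. f (g x) b)"
  by (simp add: cbilinear_def clinear_iff)

lemma cbilinear_right: "cbilinear f \<Longrightarrow> clinear g \<Longrightarrow> clinear (\<lambda>x. f a (g x))"
  by (simp add: cbilinear_def clinear_iff)

lemma clinear_zero: "clinear F \<Longrightarrow> F 0 = 0"
  by (metis add_cancel_right_right clinear_iff)

section \<open>Extensionality on pure tensors and lifted maps\<close>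

lemma tensor_eqI:
  assumes "clinear F" "clinear G" "\<And>a b. F (a \<otimes>\<^sub>t b) = G (a \<otimes>\<^sub>t b)"
  shows "F t = G t"
  using assms by (induction t rule: tensor_induct) (auto simp: clinear_zero clinear_iff)

lemma antilinear_zero:
  assumes "antilinear F"
  shows "F 0 = 0"
proof -
  have "F (0 + 0) = F 0 + F 0" using assms unfolding antilinear_def by blast
  then show ?thesis by simp
qed

lemma antilinear_tensor_eqI:
  assumes "antilinear F" "antilinear G" "\<And>a b. F (a \<otimes>\<^sub>t b) = G (a \<otimes>\<^sub>t b)"
  shows "F t = G t"
  using assms by (induction t rule: tensor_induct) (auto simp: antilinear_zero antilinear_def)

text \<open>Both sides are linear in \<open>t\<close> and agree on pure tensors. This moves a linear
  map inside a Sweedler sum.\<close>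

lemma clinear_image_tensor_lift:
  assumes "clinear F" "cbilinear f"
  shows "F (tensor_lift f t) = tensor_lift (\<lambda>x y. F (f x y)) t"
proof -
  have b: "cbilinear (\<lambda>x y. F (f x y))"
    by (intro cbilinearI clinear_comp[OF assms(1)] cbilinear_left[OF assms(2)]
      cbilinear_right[OF assms(2)] clinear_id)
  show ?thesis
    by (rule tensor_eqI[where t = t])
      (simp_all add: assms b clinear_comp[OF assms(1)] clinear_tensor_lift tensor_lift_pure)
qed

lemma tensor_lift_tensor_lift:
  "cbilinear f \<Longrightarrow> cbilinear g \<Longrightarrow>
    tensor_lift g (tensor_lift f t) = tensor_lift (\<lambda>x y. tensor_lift g (f x y)) t"
  by (rule clinear_image_tensor_lift[OF clinear_tensor_lift])

lemma tensor_lift_pure_tensor: "tensor_lift (\<otimes>\<^sub>t) t = t"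
  by (rule tensor_eqI[where t = t]) (simp_all add: tensor_linear tensor_lift_pure)

lemma tensor_lift_scaleC: "cbilinear f \<Longrightarrow> c *\<^sub>C tensor_lift f t = tensor_lift (\<lambda>x y. c *\<^sub>C f x y) t"
  by (rule clinear_image_tensor_lift) (simp_all add: tensor_linear)

lemma pure_tensor_tensor_lift: "a \<otimes>\<^sub>t tensor_lift f t = tensor_lift (\<lambda>x y. a \<otimes>\<^sub>t f x y) t"
  "tensor_lift f t \<otimes>\<^sub>t a = tensor_lift (\<lambda>x y. f x y \<otimes>\<^sub>t a) t" if "cbilinear f"
  using that by (simp_all add: tensor_linear clinear_image_tensor_lift[where F = "\<lambda>x. a \<otimes>\<^sub>t x"]
    clinear_image_tensor_lift[where F = "\<lambda>x. x \<otimes>\<^sub>t a"])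

text \<open>A Fubini rule for independent Sweedler sums: on a pure \<open>s\<close> both sides
  become the same lift over \<open>t\<close>.\<close>

lemma tensor_lift_commute:
  assumes "\<And>x y u. clinear (\<lambda>v. f x y u v)" "\<And>x y v. clinear (\<lambda>u. f x y u v)"
    "\<And>x u v. clinear (\<lambda>y. f x y u v)" "\<And>y u v. clinear (\<lambda>x. f x y u v)"
  shows "tensor_lift (\<lambda>x y. tensor_lift (\<lambda>u v. f x y u v) t) s =
    tensor_lift (\<lambda>u v. tensor_lift (\<lambda>x y. f x y u v) s) t"
  by (rule tensor_eqI[where t = s]) (simp_all add: tensor_linear assms tensor_lift_pure)

lemma tensor_lift_cong: "(\<And>x y. f x y = g x y) \<Longrightarrow> tensor_lift f t = tensor_lift g t"
  by presburger

section \<open>The algebra structure of the tensor square\<close>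

context unital_algebra
begin

lemma clinear_mult: "clinear g \<Longrightarrow> clinear (\<lambda>x. m (g x) b)" "clinear g \<Longrightarrow> clinear (\<lambda>x. m a (g x))"
  using cbilinear_left[OF bilinear_mult] cbilinear_right[OF bilinear_mult] by blast+

lemma mult_scaleC: "m (c *\<^sub>C a) b = c *\<^sub>C m a b" "m a (c *\<^sub>C b) = c *\<^sub>C m a b"
  using bilinear_mult by (auto simp: cbilinear_def clinear_iff)

lemma clinear_tensor_mult:
  "clinear g \<Longrightarrow> clinear (\<lambda>x. tensor_mult m (g x) t)" "clinear g \<Longrightarrow> clinear (\<lambda>x. tensor_mult m s (g x))"
  by (simp_all add: tensor_mult_def tensor_linear clinear_mult)

lemma tensor_mult_assoc:
  "tensor_mult m (tensor_mult m r s) t = tensor_mult m r (tensor_mult m s t)"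
proof -
  note lin = tensor_linear clinear_tensor_mult
  have 1: "tensor_mult m (tensor_mult m (a \<otimes>\<^sub>t b) (c \<otimes>\<^sub>t d)) t =
      tensor_mult m (a \<otimes>\<^sub>t b) (tensor_mult m (c \<otimes>\<^sub>t d) t)" for a b c d
    by (rule tensor_eqI[where t = t])
      (simp_all add: lin tensor_mult_pure bilinear_mult mult_assoc)
  have 2: "tensor_mult m (tensor_mult m (a \<otimes>\<^sub>t b) s) t = tensor_mult m (a \<otimes>\<^sub>t b) (tensor_mult m s t)" for a b
    by (rule tensor_eqI[where t = s]) (simp_all add: lin 1)
  show ?thesis
    by (rule tensor_eqI[where t = r]) (simp_all add: lin 2)
qed

lemma tensor_mult_unit: "tensor_mult m (u \<otimes>\<^sub>t u) t = t" "tensor_mult m t (u \<otimes>\<^sub>t u) = t"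
  by (rule tensor_eqI[where t = t];
    simp add: tensor_linear clinear_tensor_mult tensor_mult_pure bilinear_mult mult_unit_left mult_unit_right)+

end

section \<open>Sweedler notation in a coalgebra\<close>

context coalgebra
begin

text \<open>Sweedler's sum of \<open>f\<close> over h_1 \<otimes> h_2. It has this meaning only for
  bilinear \<open>f\<close>, which is why most rewriting steps below carry linearity rules.\<close>

abbreviation sweedler where "sweedler h f \<equiv> tensor_lift f (\<Delta> h)"

lemma clinear_comult: "clinear g \<Longrightarrow> clinear (\<lambda>x. \<Delta> (g x))"
  by (rule clinear_comp[OF linear_comult])

lemma clinear_counit: "clinear g \<Longrightarrow> clinear (\<lambda>x. \<epsilon> (g x))"
  by (rule clinear_comp[OF linear_counit])

lemma comult_scaleC: "\<Delta> (c *\<^sub>C a) = c *\<^sub>C \<Delta> a"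
  using clinear_comult[OF clinear_id] by (simp add: clinear_iff)

lemma sweedler_scaleC: "cbilinear f \<Longrightarrow> sweedler (c *\<^sub>C h) f = c *\<^sub>C sweedler h f"
  using linear_comult clinear_tensor_lift[of f] by (simp add: clinear_iff)

text \<open>Coassociativity tested against a trilinear map: on both sides \<open>f\<close> receives
  the three legs of the iterated coproduct in order.\<close>

lemma sweedler_coassoc:
  assumes "\<And>x y. clinear (\<lambda>z. f x y z)" "\<And>x z. clinear (\<lambda>y. f x y z)" "\<And>y z. clinear (\<lambda>x. f x y z)"
  shows "sweedler h (\<lambda>x y. sweedler x (\<lambda>z w. f z w y)) = sweedler h (\<lambda>x y. sweedler y (\<lambda>z w. f x z w))"
proof -
  note lin = tensor_linear clinear_comult assms
  have "tensor_lift (\<lambda>a. tensor_lift (f a)) (tensor_assoc (tensor_map \<Delta> id (\<Delta> h))) =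
      tensor_lift (\<lambda>a. tensor_lift (f a)) (tensor_map id \<Delta> (\<Delta> h))"
    by (simp only: coassoc)
  then show ?thesis
    by (simp add: tensor_assoc_def tensor_map_def tensor_lift_tensor_lift lin tensor_lift_pure)
qed

lemma sweedler_counit:
  assumes "clinear f"
  shows "sweedler h (\<lambda>x y. \<epsilon> x *\<^sub>C f y) = f h" "sweedler h (\<lambda>x y. \<epsilon> y *\<^sub>C f x) = f h"
proof -
  have s: "f (c *\<^sub>C x) = c *\<^sub>C f x" for c x using assms by (simp add: clinear_iff)
  note lin = tensor_linear clinear_counit
  show "sweedler h (\<lambda>x y. \<epsilon> x *\<^sub>C f y) = f h"
    using arg_cong[OF counit_left[of h], of f] by (simp add: clinear_image_tensor_lift[OF assms] lin s)
  show "sweedler h (\<lambda>x y. \<epsilon> y *\<^sub>C f x) = f h"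
    using arg_cong[OF counit_right[of h], of f] by (simp add: clinear_image_tensor_lift[OF assms] lin s)
qed

end

section \<open>The antipode reverses products and coproducts\<close>

context hopf_algebra
begin

lemma clinear_antipode: "clinear g \<Longrightarrow> clinear (\<lambda>x. S (g x))"
  by (rule clinear_comp[OF linear_antipode])

lemma antipode_scaleC: "S (c *\<^sub>C x) = c *\<^sub>C S x"
  using linear_antipode by (simp add: clinear_iff)

lemmas hopf_linear = tensor_linear clinear_mult clinear_tensor_mult clinear_comult clinear_counit
  clinear_antipode

lemma sweedler_antipode:
  assumes "clinear f"
  shows "sweedler h (\<lambda>x y. f (m (S x) y)) = \<epsilon> h *\<^sub>C f u" "sweedler h (\<lambda>x y. f (m x (S y))) = \<epsilon> h *\<^sub>C f u"
proof -
  have s: "f (c *\<^sub>C x) = c *\<^sub>C f x" for c x using assms by (simp add: clinear_iff)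
  show "sweedler h (\<lambda>x y. f (m (S x) y)) = \<epsilon> h *\<^sub>C f u"
    using arg_cong[OF antipode_left[of h], of f]
    by (simp add: clinear_image_tensor_lift[OF assms] hopf_linear s)
  show "sweedler h (\<lambda>x y. f (m x (S y))) = \<epsilon> h *\<^sub>C f u"
    using arg_cong[OF antipode_right[of h], of f]
    by (simp add: clinear_image_tensor_lift[OF assms] hopf_linear s)
qed

lemma sweedler_unit: "cbilinear f \<Longrightarrow> sweedler u f = f u u"
  by (simp add: comult_unit tensor_lift_pure)

lemma sweedler_mult:
  assumes "cbilinear f"
  shows "sweedler (m a b) f = sweedler a (\<lambda>x y. sweedler b (\<lambda>z w. f (m x z) (m y w)))"
  unfolding comult_mult tensor_mult_def
  using assms by (simp add: tensor_lift_tensor_lift hopf_linear tensor_lift_pure)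

lemma antipode_unit: "S u = u"
  using antipode_left[of u] by (simp add: sweedler_unit hopf_linear mult_unit_right counit_unit scaleC_one)

lemma counit_antipode: "\<epsilon> (S h) = \<epsilon> h"
proof -
  have "\<epsilon> h = sweedler h (\<lambda>x y. \<epsilon> (m x (S y)))"
    by (simp add: sweedler_antipode hopf_linear counit_unit scaleC_complex_def)
  also have "\<dots> = sweedler h (\<lambda>x y. \<epsilon> x *\<^sub>C \<epsilon> (S y))"
    by (simp add: counit_mult scaleC_complex_def)
  also have "\<dots> = \<epsilon> (S h)"
    by (rule sweedler_counit) (simp add: hopf_linear)
  finally show ?thesis by simp
qed

text \<open>Both sides are convolution inverses of the multiplication.\<close>

lemma antipode_mult: "S (m a b) = m (S b) (S a)"
proof -
  \<comment> \<open>\<open>?E\<close> is S(a_1 b_1) (a_2 b_2) (S b_3 S a_3). Cancelling the first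
    two factors leaves (S b)(S a); cancelling the last two leaves S(a b).\<close>
  let ?E = "sweedler a (\<lambda>x y. sweedler b (\<lambda>z w. sweedler x (\<lambda>p q. sweedler z (\<lambda>r s.
    m (S (m p r)) (m (m q s) (m (S w) (S y)))))))"
  have "?E = sweedler a (\<lambda>x y. sweedler b (\<lambda>z w. sweedler (m x z) (\<lambda>p q. m (m (S p) q) (m (S w) (S y)))))"
    by (simp add: sweedler_mult hopf_linear mult_assoc)
  also have "\<dots> = sweedler a (\<lambda>x y. \<epsilon> x *\<^sub>C sweedler b (\<lambda>z w. \<epsilon> z *\<^sub>C m (S w) (S y)))"
    by (subst sweedler_antipode)
      (simp_all add: hopf_linear counit_mult mult_unit_left tensor_lift_scaleC scaleC_scaleC)
  also have "\<dots> = m (S b) (S a)"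
    by (simp add: sweedler_counit hopf_linear)
  finally have 1: "?E = m (S b) (S a)" .
  have "?E = sweedler a (\<lambda>x y. sweedler x (\<lambda>p q. sweedler b (\<lambda>z w. sweedler z (\<lambda>r s.
    m (S (m p r)) (m (m q s) (m (S w) (S y)))))))"
    by (rule tensor_lift_cong, rule tensor_lift_commute) (simp_all add: hopf_linear)
  also have "\<dots> = sweedler a (\<lambda>x y. sweedler y (\<lambda>p q. sweedler b (\<lambda>z w. sweedler w (\<lambda>r s.
    m (S (m x z)) (m (m p r) (m (S s) (S q)))))))"
    by (simp add: sweedler_coassoc hopf_linear)
  also have "\<dots> = sweedler a (\<lambda>x y. sweedler y (\<lambda>p q. sweedler b (\<lambda>z w. sweedler w (\<lambda>r s.
    m (S (m x z)) (m p (m (m r (S s)) (S q)))))))"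
    by (simp add: mult_assoc)
  also have "\<dots> = sweedler a (\<lambda>x y. sweedler y (\<lambda>p q. sweedler b (\<lambda>z w. \<epsilon> w *\<^sub>C
    m (S (m x z)) (m p (S q)))))"
    by (subst sweedler_antipode) (simp_all add: hopf_linear mult_unit_left)
  also have "\<dots> = sweedler a (\<lambda>x y. sweedler y (\<lambda>p q. m (S (m x b)) (m p (S q))))"
    by (simp add: sweedler_counit hopf_linear)
  also have "\<dots> = sweedler a (\<lambda>x y. \<epsilon> y *\<^sub>C S (m x b))"
    by (subst sweedler_antipode) (simp_all add: hopf_linear mult_unit_right)
  also have "\<dots> = S (m a b)"
    by (simp add: sweedler_counit hopf_linear)
  finally show ?thesis using 1 by simp
qed

text \<open>Both sides are convolution inverses of \<open>\<Delta>\<close>.\<close>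

lemma comult_antipode: "\<Delta> (S h) = sweedler h (\<lambda>x y. S y \<otimes>\<^sub>t S x)"
proof -
  \<comment> \<open>The same double evaluation, now for a triple convolution product in the tensor
    square with factors \<Delta> S, \<Delta> and \<open>?t\<close>.\<close>
  let ?t = "\<lambda>y. sweedler y (\<lambda>p q. S q \<otimes>\<^sub>t S p)"
  let ?E = "sweedler h (\<lambda>x y. sweedler x (\<lambda>p q. tensor_mult m (\<Delta> (S p)) (tensor_mult m (\<Delta> q) (?t y))))"
  \<comment> \<open>\<open>?t\<close> is a right convolution inverse of \<Delta>: the two inner legs
    cancel first, then the two outer ones.\<close>
  have t: "sweedler y (\<lambda>p q. tensor_mult m (\<Delta> p) (?t q)) = \<epsilon> y *\<^sub>C (u \<otimes>\<^sub>t u)" for y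
  proof -
    have "sweedler y (\<lambda>p q. tensor_mult m (\<Delta> p) (?t q)) =
      sweedler y (\<lambda>p q. sweedler p (\<lambda>a b. sweedler q (\<lambda>c d. m a (S d) \<otimes>\<^sub>t m b (S c))))"
      by (simp add: tensor_mult_def tensor_lift_tensor_lift hopf_linear tensor_lift_pure)
    also have "\<dots> = sweedler y (\<lambda>p q. sweedler q (\<lambda>r s. sweedler r (\<lambda>b c. m p (S s) \<otimes>\<^sub>t m b (S c))))"
      by (simp add: sweedler_coassoc hopf_linear)
    also have "\<dots> = sweedler y (\<lambda>p q. sweedler q (\<lambda>r s. \<epsilon> r *\<^sub>C (m p (S s) \<otimes>\<^sub>t u)))"
      by (subst sweedler_antipode(2)) (simp_all add: hopf_linear)
    also have "\<dots> = sweedler y (\<lambda>p q. m p (S q) \<otimes>\<^sub>t u)"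
      by (simp add: sweedler_counit hopf_linear)
    also have "\<dots> = \<epsilon> y *\<^sub>C (u \<otimes>\<^sub>t u)"
      by (subst sweedler_antipode) (simp_all add: hopf_linear)
    finally show ?thesis .
  qed
  have "?E = sweedler h (\<lambda>x y. sweedler x (\<lambda>p q. tensor_mult m (\<Delta> (m (S p) q)) (?t y)))"
    by (simp add: comult_mult tensor_mult_assoc)
  also have "\<dots> = ?t h"
    by (subst sweedler_antipode)
      (simp_all add: hopf_linear comult_unit tensor_mult_unit sweedler_counit)
  finally have 1: "?E = ?t h" .
  have "?E = sweedler h (\<lambda>x y. sweedler y (\<lambda>p q. tensor_mult m (\<Delta> (S x)) (tensor_mult m (\<Delta> p) (?t q))))"
    by (subst sweedler_coassoc) (simp_all add: hopf_linear)
  also have "\<dots> = sweedler h (\<lambda>x y. tensor_mult m (\<Delta> (S x)) (\<epsilon> y *\<^sub>C (u \<otimes>\<^sub>t u)))"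
    unfolding t[symmetric] by (subst clinear_image_tensor_lift) (simp_all add: hopf_linear)
  also have "\<dots> = sweedler h (\<lambda>x y. \<epsilon> y *\<^sub>C \<Delta> (S x))"
    using clinear_tensor_mult(2)[OF clinear_id] by (simp add: clinear_iff tensor_mult_unit)
  also have "\<dots> = \<Delta> (S h)"
    by (simp add: sweedler_counit hopf_linear)
  finally show ?thesis using 1 by simp
qed

lemma sweedler_antipode_arg:
  "cbilinear f \<Longrightarrow> sweedler (S h) f = sweedler h (\<lambda>x y. f (S y) (S x))"
  by (simp add: comult_antipode tensor_lift_tensor_lift hopf_linear tensor_lift_pure)

end


section \<open>Hopf algebras with two-sided integrals\<close>

text \<open>The setting without involution. The left and right versions of both integrals are
  assumed here and later supplied by the involution; the whole induced structure is built from
  them.\<close>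

locale unimodular_hopf_algebra = hopf_algebra m u \<Delta> \<epsilon> S
  for m :: "'a::complex_vector \<Rightarrow> 'a \<Rightarrow> 'a" and u and \<Delta> and \<epsilon> and S +
  fixes I :: "'a \<Rightarrow> complex" and \<Lambda> :: 'a
  assumes linear_integral: "clinear I"
    and integral_right_invariant: "sweedler h (\<lambda>x y. I x *\<^sub>C y) = I h *\<^sub>C u"
    and integral_left_invariant: "sweedler h (\<lambda>x y. I y *\<^sub>C x) = I h *\<^sub>C u"
    and left_integral: "m h \<Lambda> = \<epsilon> h *\<^sub>C \<Lambda>"
    and right_integral: "m \<Lambda> h = \<epsilon> h *\<^sub>C \<Lambda>"
    and integral_normalised: "I \<Lambda> = 1"
begin

lemma clinear_integral: "clinear g \<Longrightarrow> clinear (\<lambda>x. I (g x))"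
  by (rule clinear_comp[OF linear_integral])

lemma integral_scaleC: "I (c *\<^sub>C x) = c * I x"
  using linear_integral by (simp add: clinear_iff scaleC_complex_def)

lemmas linear = hopf_linear clinear_integral

lemma sweedler_integral:
  assumes "clinear f"
  shows "sweedler h (\<lambda>x y. I x *\<^sub>C f y) = I h *\<^sub>C f u" "sweedler h (\<lambda>x y. I y *\<^sub>C f x) = I h *\<^sub>C f u"
proof -
  have s: "f (c *\<^sub>C x) = c *\<^sub>C f x" for c x using assms by (simp add: clinear_iff)
  show "sweedler h (\<lambda>x y. I x *\<^sub>C f y) = I h *\<^sub>C f u"
    using arg_cong[OF integral_right_invariant[of h], of f]
    by (simp add: clinear_image_tensor_lift[OF assms] linear s)
  show "sweedler h (\<lambda>x y. I y *\<^sub>C f x) = I h *\<^sub>C f u"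
    using arg_cong[OF integral_left_invariant[of h], of f]
    by (simp add: clinear_image_tensor_lift[OF assms] linear s)
qed

section \<open>Casimir elements and the inverse metric of the algebra\<close>

text \<open>Write h as \<epsilon>(h_1) h_2 and absorb the scalar by h_1 \<Lambda> = \<epsilon>(h_1)
  \<Lambda>. Expanding the coproduct of h_1 \<Lambda> produces S(h_2) h_3, which cancels.\<close>

lemma casimir:
  assumes "cbilinear f"
  shows "sweedler \<Lambda> (\<lambda>x y. f (m h x) (S y)) = sweedler \<Lambda> (\<lambda>x y. f x (m (S y) h))"
proof -
  note lin = linear cbilinear_left[OF assms] cbilinear_right[OF assms]
  have "sweedler \<Lambda> (\<lambda>x y. f x (m (S y) h)) =
      sweedler h (\<lambda>p q. \<epsilon> p *\<^sub>C sweedler \<Lambda> (\<lambda>x y. f x (m (S y) q)))"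
    by (subst sweedler_counit) (simp_all add: lin)
  also have "\<dots> = sweedler h (\<lambda>p q. sweedler (m p \<Lambda>) (\<lambda>x y. f x (m (S y) q)))"
    by (simp add: left_integral sweedler_scaleC lin)
  also have "\<dots> = sweedler h (\<lambda>p q. sweedler p (\<lambda>r s. sweedler \<Lambda> (\<lambda>x y. f (m r x) (m (S y) (m (S s) q)))))"
    by (simp add: sweedler_mult lin antipode_mult mult_assoc)
  also have "\<dots> = sweedler h (\<lambda>p q. sweedler q (\<lambda>r s. sweedler \<Lambda> (\<lambda>x y. f (m p x) (m (S y) (m (S r) s)))))"
    by (subst sweedler_coassoc) (simp_all add: lin)
  also have "\<dots> = sweedler h (\<lambda>p q. \<epsilon> q *\<^sub>C sweedler \<Lambda> (\<lambda>x y. f (m p x) (S y)))"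
    by (subst sweedler_antipode) (simp_all add: lin mult_unit_right)
  also have "\<dots> = sweedler \<Lambda> (\<lambda>x y. f (m h x) (S y))"
    by (subst sweedler_counit) (simp_all add: lin)
  finally show ?thesis by simp
qed

text \<open>The mirror image of \<open>casimir\<close>: the right integral property absorbs
  \<epsilon>(h_2), and h_1 S(h_2) cancels.\<close>

lemma casimir':
  assumes "cbilinear f"
  shows "sweedler \<Lambda> (\<lambda>x y. f (m h (S x)) y) = sweedler \<Lambda> (\<lambda>x y. f (S x) (m y h))"
proof -
  note lin = linear cbilinear_left[OF assms] cbilinear_right[OF assms]
  have "sweedler \<Lambda> (\<lambda>x y. f (m h (S x)) y) =
      sweedler h (\<lambda>p q. \<epsilon> q *\<^sub>C sweedler \<Lambda> (\<lambda>x y. f (m p (S x)) y))"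
    by (subst sweedler_counit) (simp_all add: lin)
  also have "\<dots> = sweedler h (\<lambda>p q. sweedler (m \<Lambda> q) (\<lambda>x y. f (m p (S x)) y))"
    by (simp add: right_integral sweedler_scaleC lin)
  also have "\<dots> = sweedler h (\<lambda>p q. sweedler \<Lambda> (\<lambda>x y. sweedler q (\<lambda>r s. f (m p (m (S r) (S x))) (m y s))))"
    by (simp add: sweedler_mult lin antipode_mult)
  also have "\<dots> = sweedler h (\<lambda>p q. sweedler q (\<lambda>r s. sweedler \<Lambda> (\<lambda>x y. f (m (m p (S r)) (S x)) (m y s))))"
    by (rule tensor_lift_cong, subst tensor_lift_commute) (simp_all add: lin mult_assoc)
  also have "\<dots> = sweedler h (\<lambda>p q. sweedler p (\<lambda>r s. sweedler \<Lambda> (\<lambda>x y. f (m (m r (S s)) (S x)) (m y q))))"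
    by (subst sweedler_coassoc) (simp_all add: lin)
  also have "\<dots> = sweedler h (\<lambda>p q. \<epsilon> p *\<^sub>C sweedler \<Lambda> (\<lambda>x y. f (S x) (m y q)))"
    by (subst sweedler_antipode) (simp_all add: lin mult_unit_left)
  also have "\<dots> = sweedler \<Lambda> (\<lambda>x y. f (S x) (m y h))"
    by (subst sweedler_counit) (simp_all add: lin)
  finally show ?thesis .
qed

text \<open>\<open>casimir\<close> moves h out of the integral; right invariance then evaluates the
  rest at \<integral>\<Lambda> = 1 and S 1 = 1.\<close>

lemma metric_right:
  assumes "clinear f"
  shows "sweedler \<Lambda> (\<lambda>x y. I (m h x) *\<^sub>C f (S y)) = f h"
  by (subst casimir) (simp_all add: linear clinear_comp[OF assms] sweedler_integral integral_normalised
    antipode_unit mult_unit_left scaleC_one)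

lemma metric_left:
  assumes "clinear f"
  shows "sweedler \<Lambda> (\<lambda>x y. I (m y h) *\<^sub>C f (S x)) = f h"
  by (subst casimir'[symmetric]) (simp_all add: linear clinear_comp[OF assms] sweedler_integral
    integral_normalised antipode_unit mult_unit_right scaleC_one)

text \<open>A right inverse and a left inverse of the metric coincide.\<close>

lemma metric_eq:
  assumes "cbilinear f"
  shows "sweedler \<Lambda> (\<lambda>x y. f x (S y)) = sweedler \<Lambda> (\<lambda>x y. f (S x) y)"
proof -
  note lin = linear cbilinear_left[OF assms] cbilinear_right[OF assms]
  have "sweedler \<Lambda> (\<lambda>x y. f (S x) y) =
      sweedler \<Lambda> (\<lambda>x y. sweedler \<Lambda> (\<lambda>p q. I (m y p) *\<^sub>C f (S x) (S q)))"
    by (subst metric_right) (simp_all add: lin)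
  also have "\<dots> = sweedler \<Lambda> (\<lambda>p q. sweedler \<Lambda> (\<lambda>x y. I (m y p) *\<^sub>C f (S x) (S q)))"
    by (rule tensor_lift_commute) (simp_all add: lin)
  also have "\<dots> = sweedler \<Lambda> (\<lambda>x y. f x (S y))"
    by (subst metric_left) (simp_all add: lin)
  finally show ?thesis by simp
qed

lemma metric_right':
  assumes "clinear f"
  shows "sweedler \<Lambda> (\<lambda>x y. I (m h (S x)) *\<^sub>C f y) = f h"
  by (subst metric_eq[symmetric]) (simp_all add: linear clinear_comp[OF assms] metric_right assms)

text \<open>Expand \<Lambda> itself by \<open>metric_right\<close>; the factor \<Lambda> \<Lambda>_1
  = \<epsilon>(\<Lambda>_1) \<Lambda> collapses the sum to S \<Lambda>.\<close>

lemma antipode_integral_element: "S \<Lambda> = \<Lambda>"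
proof -
  have "\<Lambda> = sweedler \<Lambda> (\<lambda>x y. I (m \<Lambda> x) *\<^sub>C S y)"
    using metric_right[OF clinear_id] by simp
  also have "\<dots> = S \<Lambda>"
    by (simp add: right_integral integral_scaleC integral_normalised sweedler_counit linear)
  finally show ?thesis by simp
qed

section \<open>The Frobenius form of the coalgebra\<close>

text \<open>The dual of \<open>casimir\<close>. Right invariance at (S h_2) k inserts a second leg;
  as S reverses coproducts, this leg begins with an antipode factor that cancels against
  h_1.\<close>

lemma form_casimir:
  assumes "clinear f"
  shows "sweedler h (\<lambda>x y. I (m (S y) k) *\<^sub>C f x) = sweedler k (\<lambda>x y. I (m (S h) x) *\<^sub>C f y)"
proof -
  note lin = linear clinear_comp[OF assms]
  have "sweedler h (\<lambda>x y. I (m (S y) k) *\<^sub>C f x) =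
      sweedler h (\<lambda>x y. sweedler (m (S y) k) (\<lambda>p q. I p *\<^sub>C f (m x q)))"
    by (subst sweedler_integral) (simp_all add: lin mult_unit_right)
  also have "\<dots> = sweedler h (\<lambda>x y. sweedler y (\<lambda>a b. sweedler k (\<lambda>c d. I (m (S b) c) *\<^sub>C f (m (m x (S a)) d))))"
    by (simp add: sweedler_mult sweedler_antipode_arg lin mult_assoc)
  also have "\<dots> = sweedler h (\<lambda>x y. sweedler x (\<lambda>a b. sweedler k (\<lambda>c d. I (m (S y) c) *\<^sub>C f (m (m a (S b)) d))))"
    by (subst sweedler_coassoc) (simp_all add: lin)
  also have "\<dots> = sweedler h (\<lambda>x y. \<epsilon> x *\<^sub>C sweedler k (\<lambda>c d. I (m (S y) c) *\<^sub>C f d))"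
    by (subst sweedler_antipode) (simp_all add: lin mult_unit_left assms)
  also have "\<dots> = sweedler k (\<lambda>x y. I (m (S h) x) *\<^sub>C f y)"
    by (subst sweedler_counit) (simp_all add: lin assms)
  finally show ?thesis .
qed

text \<open>The counterpart of \<open>form_casimir\<close> from left invariance, inserted at k (S
  h_1).\<close>

lemma form_casimir':
  assumes "clinear f"
  shows "sweedler k (\<lambda>x y. I (m y (S h)) *\<^sub>C f x) = sweedler h (\<lambda>x y. I (m k (S x)) *\<^sub>C f y)"
proof -
  note lin = linear clinear_comp[OF assms]
  have "sweedler h (\<lambda>x y. I (m k (S x)) *\<^sub>C f y) =
      sweedler h (\<lambda>x y. sweedler (m k (S x)) (\<lambda>p q. I q *\<^sub>C f (m p y)))"
    by (subst sweedler_integral) (simp_all add: lin mult_unit_left)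
  also have "\<dots> = sweedler h (\<lambda>x y. sweedler k (\<lambda>c d. sweedler x (\<lambda>a b. I (m d (S a)) *\<^sub>C f (m c (m (S b) y)))))"
    by (simp add: sweedler_mult sweedler_antipode_arg lin mult_assoc)
  also have "\<dots> = sweedler h (\<lambda>x y. sweedler x (\<lambda>a b. sweedler k (\<lambda>c d. I (m d (S a)) *\<^sub>C f (m c (m (S b) y)))))"
    by (rule tensor_lift_cong, rule tensor_lift_commute) (simp_all add: lin)
  also have "\<dots> = sweedler h (\<lambda>x y. sweedler y (\<lambda>a b. sweedler k (\<lambda>c d. I (m d (S x)) *\<^sub>C f (m c (m (S a) b)))))"
    by (subst sweedler_coassoc) (simp_all add: lin)
  also have "\<dots> = sweedler h (\<lambda>x y. \<epsilon> y *\<^sub>C sweedler k (\<lambda>c d. I (m d (S x)) *\<^sub>C f c))"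
    by (subst sweedler_antipode) (simp_all add: lin mult_unit_right assms)
  also have "\<dots> = sweedler k (\<lambda>x y. I (m y (S h)) *\<^sub>C f x)"
    by (subst sweedler_counit) (simp_all add: lin assms)
  finally show ?thesis by simp
qed

text \<open>Both forms have inverse metric \<open>\<Delta> \<Lambda>\<close>.\<close>

lemma form_eq: "I (m (S k) h) = I (m k (S h))"
proof -
  \<comment> \<open>By \<open>form_casimir'\<close> the sum of \<Lambda>_1 \<integral>\<Lambda>_2 (S
    h) is h. Dually, by \<open>form_casimir\<close>, the sum of \<integral>(S k) \<Lambda>_1 times
    \<Lambda>_2 is k.\<close>
  have "I (m (S k) h) = sweedler \<Lambda> (\<lambda>x y. I (m y (S h)) *\<^sub>C I (m (S k) x))"
    by (subst form_casimir') (simp_all add: linear right_integral integral_scaleC integral_normalised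
      counit_antipode sweedler_counit)
  also have "\<dots> = sweedler \<Lambda> (\<lambda>x y. I (m (S k) x) *\<^sub>C I (m y (S h)))"
    by (simp add: scaleC_complex_def mult.commute)
  also have "\<dots> = I (m k (S h))"
    by (subst form_casimir[symmetric]) (simp_all add: linear left_integral integral_scaleC
      integral_normalised counit_antipode sweedler_counit)
  finally show ?thesis .
qed

section \<open>The induced operations and their equivalent expressions\<close>

abbreviation dcomult where "dcomult \<equiv> induced_comult m \<Delta> S \<Lambda>"

abbreviation dmult where "dmult \<equiv> induced_mult m \<Delta> S I"

text \<open>The Casimir identities move h across the metric, and \<open>metric_eq\<close> moves S to
  the other leg. Later proofs choose the form whose h or S stands where a cancellation is
  wanted.\<close>

lemma dcomult_eq:
  "dcomult h = sweedler \<Lambda> (\<lambda>x y. x \<otimes>\<^sub>t m (S y) h)"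
  "dcomult h = sweedler \<Lambda> (\<lambda>x y. m h x \<otimes>\<^sub>t S y)"
  "dcomult h = sweedler \<Lambda> (\<lambda>x y. S x \<otimes>\<^sub>t m y h)"
  "dcomult h = sweedler \<Lambda> (\<lambda>x y. m h (S x) \<otimes>\<^sub>t y)"
proof -
  show 1: "dcomult h = sweedler \<Lambda> (\<lambda>x y. x \<otimes>\<^sub>t m (S y) h)"
    by (simp add: induced_comult_def tensor_map_def)
  then show 2: "dcomult h = sweedler \<Lambda> (\<lambda>x y. m h x \<otimes>\<^sub>t S y)"
    by (subst casimir) (simp_all add: linear)
  from 1 show 3: "dcomult h = sweedler \<Lambda> (\<lambda>x y. S x \<otimes>\<^sub>t m y h)"
    by (subst metric_eq[symmetric]) (simp_all add: linear)
  from 3 show "dcomult h = sweedler \<Lambda> (\<lambda>x y. m h (S x) \<otimes>\<^sub>t y)"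
    by (subst casimir') (simp_all add: linear)
qed

lemma clinear_dcomult: "clinear g \<Longrightarrow> clinear (\<lambda>x. dcomult (g x))"
  by (simp add: dcomult_eq(1) linear)

text \<open>The second form, from \<open>form_casimir\<close>, takes the coproduct of the right
  argument; the third, from \<open>form_eq\<close>, moves the antipode inside the integral.\<close>

lemma dmult_eq:
  "dmult h k = sweedler h (\<lambda>x y. I (m (S y) k) *\<^sub>C x)"
  "dmult h k = sweedler k (\<lambda>x y. I (m (S h) x) *\<^sub>C y)"
  "dmult h k = sweedler h (\<lambda>x y. I (m y (S k)) *\<^sub>C x)"
proof -
  show 1: "dmult h k = sweedler h (\<lambda>x y. I (m (S y) k) *\<^sub>C x)"
    by (simp add: induced_mult_def)
  then show "dmult h k = sweedler k (\<lambda>x y. I (m (S h) x) *\<^sub>C y)"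
    by (subst form_casimir[symmetric]) (simp_all add: linear)
  from 1 show "dmult h k = sweedler h (\<lambda>x y. I (m y (S k)) *\<^sub>C x)"
    by (simp add: form_eq)
qed

lemma clinear_dmult: "clinear g \<Longrightarrow> clinear (\<lambda>x. dmult (g x) k)" "clinear g \<Longrightarrow> clinear (\<lambda>x. dmult h (g x))"
  by (simp_all add: dmult_eq(1) linear)

lemmas dual_linear = linear clinear_dcomult clinear_dmult

section \<open>The F-algebra on the given product\<close>

text \<open>The counit laws are \<open>metric_right\<close> and \<open>metric_left\<close>. Both
  sides of coassociativity are sums over two copies of \<Lambda>, and \<open>casimir\<close> is used
  twice to carry a factor from one copy through the other.\<close>

lemma coalgebra_dcomult: "coalgebra dcomult I"
proof (rule coalgebra.intro)
  fix h
  show "clinear dcomult" using clinear_dcomult[OF clinear_id] by simp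
  show "clinear I" by (rule linear_integral)
  show "tensor_lift (\<lambda>x y. I x *\<^sub>C y) (dcomult h) = h"
    using metric_right[OF clinear_id, of h]
    by (simp add: dcomult_eq(2) tensor_lift_tensor_lift linear tensor_lift_pure)
  show "tensor_lift (\<lambda>x y. I y *\<^sub>C x) (dcomult h) = h"
    using metric_left[OF clinear_id, of h]
    by (simp add: dcomult_eq(3) tensor_lift_tensor_lift linear tensor_lift_pure)
  have "tensor_assoc (tensor_map dcomult id (dcomult h)) =
      sweedler \<Lambda> (\<lambda>x y. sweedler \<Lambda> (\<lambda>p q. m x p \<otimes>\<^sub>t S q \<otimes>\<^sub>t m (S y) h))"
    unfolding tensor_map_def tensor_assoc_def id_apply dcomult_eq(1)[of h]
    by (simp add: dcomult_eq(2) tensor_lift_tensor_lift dual_linear tensor_lift_pure)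
  also have "\<dots> = sweedler \<Lambda> (\<lambda>x y. sweedler \<Lambda> (\<lambda>p q. p \<otimes>\<^sub>t m (S q) x \<otimes>\<^sub>t m (S y) h))"
    by (rule tensor_lift_cong, rule casimir) (simp add: linear)
  also have "\<dots> = sweedler \<Lambda> (\<lambda>p q. sweedler \<Lambda> (\<lambda>x y. p \<otimes>\<^sub>t m (S q) x \<otimes>\<^sub>t m (S y) h))"
    by (rule tensor_lift_commute) (simp_all add: linear)
  also have "\<dots> = sweedler \<Lambda> (\<lambda>p q. sweedler \<Lambda> (\<lambda>x y. p \<otimes>\<^sub>t x \<otimes>\<^sub>t m (S y) (m (S q) h)))"
    unfolding mult_assoc[symmetric]
    by (rule tensor_lift_cong, rule casimir[where f = "\<lambda>x y. p \<otimes>\<^sub>t x \<otimes>\<^sub>t m y h" for p]) (simp add: linear)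
  also have "\<dots> = tensor_map id dcomult (dcomult h)"
    unfolding tensor_map_def tensor_assoc_def id_apply dcomult_eq(1)
    by (simp add: tensor_lift_tensor_lift dual_linear tensor_lift_pure
      clinear_image_tensor_lift[OF clinear_pure_right[OF clinear_id]])
  finally show "tensor_assoc (tensor_map dcomult id (dcomult h)) = tensor_map id dcomult (dcomult h)" .
qed

text \<open>The first expression of \<open>dcomult\<close> commutes with right multiplication and
  the second with left multiplication, so each Frobenius relation reduces to associativity of
  \<open>m\<close>.\<close>

lemma F_algebra_dcomult: "F_algebra m u dcomult I"
proof (intro F_algebra.intro unital_algebra_axioms coalgebra_dcomult F_algebra_axioms.intro)
  fix t
  show "tensor_map id (tensor_lift m) (tensor_assoc (tensor_map dcomult id t)) = dcomult (tensor_lift m t)"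
    unfolding tensor_map_def tensor_assoc_def id_apply
    by (rule tensor_eqI[where t = t])
      (simp_all add: dcomult_eq(1) tensor_lift_tensor_lift dual_linear tensor_lift_pure mult_assoc)
  show "dcomult (tensor_lift m t) =
      tensor_map (tensor_lift m) id (tensor_assoc_inv (tensor_map id dcomult t))"
    unfolding tensor_map_def tensor_assoc_inv_def id_apply
    by (rule tensor_eqI[where t = t])
      (simp_all add: dcomult_eq(2) tensor_lift_tensor_lift dual_linear tensor_lift_pure mult_assoc)
qed

section \<open>The F-algebra on the given coproduct\<close>

lemma form_dmult_left: "I (m (S (dmult h k)) l) = sweedler k (\<lambda>x y. I (m (S h) x) *\<^sub>C I (m (S y) l))"
proof -
  have F: "clinear (\<lambda>z. I (m (S z) l))" by (simp add: linear)
  show ?thesis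
    unfolding dmult_eq(2)
    by (simp add: clinear_image_tensor_lift[OF F] linear antipode_scaleC mult_scaleC integral_scaleC
      scaleC_complex_def)
qed

lemma form_dmult_right: "I (m (S h) (dmult k l)) = sweedler k (\<lambda>x y. I (m (S y) l) *\<^sub>C I (m (S h) x))"
proof -
  have F: "clinear (\<lambda>z. I (m (S h) z))" by (simp add: linear)
  show ?thesis
    unfolding dmult_eq(1)
    by (simp add: clinear_image_tensor_lift[OF F] linear antipode_scaleC mult_scaleC integral_scaleC
      scaleC_complex_def)
qed

lemma form_dmult: "I (m (S (dmult h k)) l) = I (m (S h) (dmult k l))"
  by (simp add: form_dmult_left form_dmult_right scaleC_complex_def mult.commute)

text \<open>The form turns \<open>dmult\<close> into the transpose of \<Delta>, with the factors in
  reversed order. Associativity of \<open>dmult\<close> thereby becomes coassociativity of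
  \<Delta>.\<close>

lemma form_dmult_sweedler:
  "I (m (S (dmult h k)) l) = sweedler l (\<lambda>x y. I (m (S k) x) *\<^sub>C I (m (S h) y))"
  unfolding form_dmult form_dmult_right by (rule form_casimir) (simp add: linear)

lemma unital_algebra_dmult: "unital_algebra dmult \<Lambda>"
proof
  fix a b c
  show "cbilinear dmult" by (simp add: dual_linear)
  show "dmult \<Lambda> a = a"
    by (simp add: dmult_eq(2) antipode_integral_element right_integral integral_scaleC
      integral_normalised sweedler_counit linear)
  show "dmult a \<Lambda> = a"
    by (simp add: dmult_eq(1) counit_antipode left_integral integral_scaleC mult_scaleC
      integral_normalised sweedler_counit linear)
  have assoc: "(c *\<^sub>C d) *\<^sub>C v = c *\<^sub>C d *\<^sub>C v" for c d :: complex and v :: 'a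
    by (simp add: scaleC_scaleC scaleC_complex_def)
  have "dmult (dmult a b) c = sweedler c (\<lambda>x y. sweedler x (\<lambda>p q. I (m (S b) p) *\<^sub>C I (m (S a) q) *\<^sub>C y))"
    unfolding dmult_eq(2)[of _ c] form_dmult_sweedler
    by (rule tensor_lift_cong, subst clinear_image_tensor_lift[where F = "\<lambda>z. z *\<^sub>C v" for v])
      (simp_all add: linear assoc)
  also have "\<dots> = sweedler c (\<lambda>x y. I (m (S b) x) *\<^sub>C sweedler y (\<lambda>p q. I (m (S a) p) *\<^sub>C q))"
    by (subst sweedler_coassoc) (simp_all add: linear tensor_lift_scaleC)
  also have "\<dots> = sweedler c (\<lambda>x y. dmult a (I (m (S b) x) *\<^sub>C y))"
    using clinear_dmult(2)[OF clinear_id] by (simp add: dmult_eq(2)[symmetric] clinear_iff)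
  also have "\<dots> = dmult a (dmult b c)"
    unfolding dmult_eq(2)[of b c]
    by (subst clinear_image_tensor_lift[where F = "dmult a"]) (simp_all add: dual_linear)
  finally show "dmult (dmult a b) c = dmult a (dmult b c)" .
qed

lemma dcomult_scaleC: "dcomult (c *\<^sub>C a) = c *\<^sub>C dcomult a"
  using clinear_dcomult[OF clinear_id] by (simp add: clinear_iff)

text \<open>The Frobenius relations on pure tensors. Each is coassociativity, applied to the
  expression of \<open>dmult\<close> that splits the left or the right argument.\<close>

lemma comult_dmult:
  "\<Delta> (dmult a b) = sweedler a (\<lambda>x y. x \<otimes>\<^sub>t dmult y b)"
  "\<Delta> (dmult a b) = sweedler b (\<lambda>x y. dmult a x \<otimes>\<^sub>t y)"
proof -
  have "\<Delta> (dmult a b) = sweedler a (\<lambda>x y. sweedler x (\<lambda>p q. I (m (S y) b) *\<^sub>C (p \<otimes>\<^sub>t q)))"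
    unfolding dmult_eq(1)
    by (simp add: clinear_image_tensor_lift[OF linear_comult] linear comult_scaleC
      tensor_lift_scaleC[symmetric] tensor_lift_pure_tensor)
  also have "\<dots> = sweedler a (\<lambda>x y. x \<otimes>\<^sub>t dmult y b)"
    by (subst sweedler_coassoc) (simp_all add: dmult_eq(1) linear pure_tensor_tensor_lift pure_tensor_scaleC_right)
  finally show "\<Delta> (dmult a b) = sweedler a (\<lambda>x y. x \<otimes>\<^sub>t dmult y b)" .
  have "\<Delta> (dmult a b) = sweedler b (\<lambda>x y. sweedler y (\<lambda>p q. I (m (S a) x) *\<^sub>C (p \<otimes>\<^sub>t q)))"
    unfolding dmult_eq(2)
    by (simp add: clinear_image_tensor_lift[OF linear_comult] linear comult_scaleC
      tensor_lift_scaleC[symmetric] tensor_lift_pure_tensor)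
  also have "\<dots> = sweedler b (\<lambda>x y. sweedler x (\<lambda>p q. I (m (S a) p) *\<^sub>C (q \<otimes>\<^sub>t y)))"
    by (subst sweedler_coassoc) (simp_all add: linear)
  also have "\<dots> = sweedler b (\<lambda>x y. dmult a x \<otimes>\<^sub>t y)"
    by (rule tensor_lift_cong) (simp add: dmult_eq(2) linear pure_tensor_tensor_lift pure_tensor_scaleC_left)
  finally show "\<Delta> (dmult a b) = sweedler b (\<lambda>x y. dmult a x \<otimes>\<^sub>t y)" .
qed

lemma F_algebra_dmult: "F_algebra dmult \<Lambda> \<Delta> \<epsilon>"
proof (intro F_algebra.intro unital_algebra_dmult coalgebra_axioms F_algebra_axioms.intro)
  fix t
  show "tensor_map id (tensor_lift dmult) (tensor_assoc (tensor_map \<Delta> id t)) = \<Delta> (tensor_lift dmult t)"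
    unfolding tensor_map_def tensor_assoc_def id_apply
    by (rule tensor_eqI[where t = t])
      (simp_all add: comult_dmult(1) tensor_lift_tensor_lift dual_linear tensor_lift_pure
        clinear_image_tensor_lift[OF clinear_pure_left[OF clinear_id]])
  show "\<Delta> (tensor_lift dmult t) =
      tensor_map (tensor_lift dmult) id (tensor_assoc_inv (tensor_map id \<Delta> t))"
    unfolding tensor_map_def tensor_assoc_inv_def id_apply
    by (rule tensor_eqI[where t = t])
      (simp_all add: comult_dmult(2) tensor_lift_tensor_lift dual_linear tensor_lift_pure
        clinear_image_tensor_lift[OF clinear_pure_right[OF clinear_id]])
qed

section \<open>Bialgebra axioms of the dual\<close>

text \<open>Expanding the product gives w_1 \<integral>S(w_2) w_3 h, where the antipode cancels. It
  serves both the compatibility of \<open>dcomult\<close> with \<open>dmult\<close> and the left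
  antipode law.\<close>

lemma sweedler_dmult: "sweedler w (\<lambda>x y. dmult x (m y h)) = I h *\<^sub>C w"
proof -
  have "sweedler w (\<lambda>x y. dmult x (m y h)) =
      sweedler w (\<lambda>x y. sweedler x (\<lambda>p q. I (m (m (S q) y) h) *\<^sub>C p))"
    by (simp add: dmult_eq(1) mult_assoc)
  also have "\<dots> = sweedler w (\<lambda>x y. sweedler y (\<lambda>p q. I (m (m (S p) q) h) *\<^sub>C x))"
    by (rule sweedler_coassoc) (simp_all add: linear)
  also have "\<dots> = sweedler w (\<lambda>x y. \<epsilon> y *\<^sub>C I h *\<^sub>C x)"
    by (subst sweedler_antipode) (simp_all add: linear mult_unit_left)
  also have "\<dots> = I h *\<^sub>C w"
    by (subst sweedler_counit) (simp_all add: linear)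
  finally show ?thesis .
qed

text \<open>The third form of \<open>dmult\<close> gives v_1 \<integral>v_2 (S \<Lambda>_1) in the
  first slot; \<open>metric_right'\<close> then puts v_2 in place of \<Lambda>_2, so a copy of
  \<Lambda> is traded for a coproduct of v.\<close>

lemma metric_dmult:
  assumes "cbilinear F"
  shows "sweedler \<Lambda> (\<lambda>x y. F (dmult v x) (S y)) = sweedler v (\<lambda>x y. F x (S y))"
proof -
  note lin = linear cbilinear_left[OF assms] cbilinear_right[OF assms]
  have s: "F (c *\<^sub>C x) y = c *\<^sub>C F x y" for c x y
    using assms by (simp add: cbilinear_def clinear_iff)
  have "sweedler \<Lambda> (\<lambda>x y. F (dmult v x) (S y)) =
      sweedler \<Lambda> (\<lambda>x y. sweedler v (\<lambda>p q. I (m q (S x)) *\<^sub>C F p (S y)))"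
    by (rule tensor_lift_cong, unfold dmult_eq(3), subst clinear_image_tensor_lift[where F = "\<lambda>z. F z a" for a])
      (simp_all add: lin s)
  also have "\<dots> = sweedler v (\<lambda>p q. sweedler \<Lambda> (\<lambda>x y. I (m q (S x)) *\<^sub>C F p (S y)))"
    by (rule tensor_lift_commute) (simp_all add: lin)
  also have "\<dots> = sweedler v (\<lambda>x y. F x (S y))"
    by (rule tensor_lift_cong, rule metric_right'[where f = "\<lambda>y. F p (S y)" for p]) (simp add: lin)
  finally show ?thesis .
qed

lemma dcomult_dmult: "dcomult (dmult h k) = tensor_mult dmult (dcomult h) (dcomult k)"
proof -
  have "tensor_mult dmult (dcomult h) (dcomult k) =
      sweedler \<Lambda> (\<lambda>x y. sweedler \<Lambda> (\<lambda>z w. dmult (m h x) z \<otimes>\<^sub>t dmult (S y) (m (S w) k)))"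
    \<comment> \<open>Different forms are chosen for the two factors so that the first slot is a
      product with a bare leg of the second \<Lambda>, as \<open>metric_dmult\<close>
      requires.\<close>
    unfolding tensor_mult_def dcomult_eq(2)[of h] dcomult_eq(1)[of k]
    by (simp add: tensor_lift_tensor_lift dual_linear tensor_lift_pure)
  also have "\<dots> = sweedler \<Lambda> (\<lambda>x y. sweedler (m h x) (\<lambda>z w. z \<otimes>\<^sub>t dmult (S y) (m (S w) k)))"
    by (rule tensor_lift_cong, rule metric_dmult[where F = "\<lambda>z w. z \<otimes>\<^sub>t dmult (S y) (m w k)" for y])
      (simp add: dual_linear)
  also have "\<dots> = sweedler \<Lambda> (\<lambda>x y. sweedler h (\<lambda>p q. sweedler x (\<lambda>a b.
      m p a \<otimes>\<^sub>t dmult (S y) (m (S b) (m (S q) k)))))"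
    by (simp add: sweedler_mult dual_linear antipode_mult mult_assoc)
  also have "\<dots> = sweedler h (\<lambda>p q. sweedler \<Lambda> (\<lambda>x y. sweedler x (\<lambda>a b.
      m p a \<otimes>\<^sub>t dmult (S y) (m (S b) (m (S q) k)))))"
    by (rule tensor_lift_commute) (simp_all add: dual_linear)
  also have "\<dots> = sweedler h (\<lambda>p q. sweedler \<Lambda> (\<lambda>x y. sweedler y (\<lambda>a b.
      m p x \<otimes>\<^sub>t dmult (S b) (m (S a) (m (S q) k)))))"
    by (subst sweedler_coassoc) (simp_all add: dual_linear)
  \<comment> \<open>The two antipodes, in reversed order, are the coproduct of S \<Lambda>_2, so
    \<open>sweedler_dmult\<close> applies with \<open>w\<close> equal to S \<Lambda>_2.\<close>
  also have "\<dots> = sweedler h (\<lambda>p q. sweedler \<Lambda> (\<lambda>x y. sweedler (S y) (\<lambda>a b.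
      m p x \<otimes>\<^sub>t dmult a (m b (m (S q) k)))))"
    by (simp add: sweedler_antipode_arg dual_linear)
  also have "\<dots> = sweedler h (\<lambda>p q. sweedler \<Lambda> (\<lambda>x y. I (m (S q) k) *\<^sub>C (m p x \<otimes>\<^sub>t S y)))"
    by (simp add: pure_tensor_tensor_lift[symmetric] dual_linear sweedler_dmult pure_tensor_scaleC_right)
  also have "\<dots> = sweedler h (\<lambda>p q. dcomult (I (m (S q) k) *\<^sub>C p))"
    by (simp add: dcomult_scaleC) (simp add: dcomult_eq(2) tensor_lift_scaleC linear)
  also have "\<dots> = dcomult (dmult h k)"
    unfolding dmult_eq(1)
    by (subst clinear_image_tensor_lift[where F = dcomult]) (simp_all add: dual_linear)
  finally show ?thesis by simp
qed

lemma integral_dmult: "I (dmult h k) = I h * I k"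
proof -
  have "I (dmult h k) = sweedler h (\<lambda>x y. I x *\<^sub>C I (m (S y) k))"
    unfolding dmult_eq(1)
    by (subst clinear_image_tensor_lift[where F = I])
      (simp_all add: linear integral_scaleC linear_integral scaleC_complex_def mult.commute)
  also have "\<dots> = I h * I k"
    by (subst sweedler_integral) (simp_all add: linear antipode_unit mult_unit_left scaleC_complex_def)
  finally show ?thesis .
qed

lemma dcomult_integral_element: "dcomult \<Lambda> = \<Lambda> \<otimes>\<^sub>t \<Lambda>"
  unfolding dcomult_eq(1)
  by (simp add: left_integral counit_antipode pure_tensor_scaleC_right sweedler_counit linear)

section \<open>The antipode of the dual\<close>

text \<open>The expansion in \<open>metric_right\<close> with its antipode left off, so that
  applying S restores h.\<close>

definition antipode_inverse where "antipode_inverse h = sweedler \<Lambda> (\<lambda>x y. I (m h x) *\<^sub>C y)"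

lemma clinear_antipode_inverse: "clinear g \<Longrightarrow> clinear (\<lambda>x. antipode_inverse (g x))"
  by (simp add: antipode_inverse_def linear)

lemma antipode_antipode_inverse: "S (antipode_inverse h) = h"
proof -
  have "S (antipode_inverse h) = sweedler \<Lambda> (\<lambda>x y. I (m h x) *\<^sub>C S y)"
    unfolding antipode_inverse_def
    by (simp add: clinear_image_tensor_lift[OF linear_antipode] linear antipode_scaleC)
  then show ?thesis using metric_right[OF clinear_id] by simp
qed

text \<open>At S h the defining sum is the second form of \<open>dmult h \<Lambda>\<close>, and
  \<Lambda> is the unit of \<open>dmult\<close>.\<close>

lemma antipode_inverse_antipode: "antipode_inverse (S h) = h"
  unfolding antipode_inverse_def dmult_eq(2)[symmetric]
  by (rule unital_algebra.mult_unit_right[OF unital_algebra_dmult])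

lemma hopf_algebra_dual: "hopf_algebra dmult \<Lambda> dcomult I antipode_inverse"
proof (intro hopf_algebra.intro hopf_algebra_axioms.intro bialgebra.intro bialgebra_axioms.intro
    unital_algebra_dmult coalgebra_dcomult dcomult_dmult integral_dmult dcomult_integral_element
    integral_normalised)
  fix h
  note lin = dual_linear clinear_antipode_inverse
  show "clinear antipode_inverse"
    using clinear_antipode_inverse[OF clinear_id] by simp
  \<comment> \<open>The third form of \<open>dcomult\<close> has S on the first leg, where
    \<open>antipode_inverse\<close> removes it; what remains is \<open>sweedler_dmult\<close> at
    \<Lambda>.\<close>
  show "tensor_lift (\<lambda>x y. dmult (antipode_inverse x) y) (dcomult h) = I h *\<^sub>C \<Lambda>"
    unfolding dcomult_eq(3)
    by (simp add: tensor_lift_tensor_lift lin tensor_lift_pure antipode_inverse_antipode sweedler_dmult)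
  \<comment> \<open>Here the second form has S on the second leg. The remaining product is h_1
    \<Lambda>_1 \<integral>h_2 \<Lambda>_2 (S \<Lambda>_3), which collapses by the antipode axiom,
    the left integral property and left invariance.\<close>
  have "tensor_lift (\<lambda>x y. dmult x (antipode_inverse y)) (dcomult h) =
      sweedler \<Lambda> (\<lambda>x y. sweedler h (\<lambda>p q. sweedler x (\<lambda>a b. I (m q (m b (S y))) *\<^sub>C m p a)))"
    unfolding dcomult_eq(2)
    by (simp add: tensor_lift_tensor_lift lin tensor_lift_pure antipode_inverse_antipode
      dmult_eq(3) sweedler_mult mult_assoc)
  also have "\<dots> = sweedler h (\<lambda>p q. sweedler \<Lambda> (\<lambda>x y. sweedler x (\<lambda>a b. I (m q (m b (S y))) *\<^sub>C m p a)))"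
    by (rule tensor_lift_commute) (simp_all add: linear)
  also have "\<dots> = sweedler h (\<lambda>p q. sweedler \<Lambda> (\<lambda>x y. sweedler y (\<lambda>a b. I (m q (m a (S b))) *\<^sub>C m p x)))"
    by (subst sweedler_coassoc) (simp_all add: linear)
  also have "\<dots> = sweedler h (\<lambda>p q. sweedler \<Lambda> (\<lambda>x y. \<epsilon> y *\<^sub>C I q *\<^sub>C m p x))"
    by (subst sweedler_antipode) (simp_all add: linear mult_unit_right)
  also have "\<dots> = sweedler h (\<lambda>p q. I q *\<^sub>C \<epsilon> p *\<^sub>C \<Lambda>)"
    by (subst sweedler_counit) (simp_all add: linear left_integral)
  also have "\<dots> = I h *\<^sub>C \<Lambda>"
    by (subst sweedler_integral) (simp_all add: linear counit_unit scaleC_one)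
  finally show "tensor_lift (\<lambda>x y. dmult x (antipode_inverse y)) (dcomult h) = I h *\<^sub>C \<Lambda>" .
qed

end


section \<open>The involution\<close>

context star_algebra
begin

lemma star_scaleC: "st (c *\<^sub>C x) = cnj c *\<^sub>C st x"
  using antilinear_star by (simp add: antilinear_def)

lemma star_unit: "st u = u"
  by (metis mult_unit_left mult_unit_right star_mult star_star)

lemma antilinear_dagger: "antilinear (tensor_dagger st)"
proof -
  have "clinear (tensor_flip :: ('a, 'a) tensor \<Rightarrow> _)"
    unfolding tensor_flip_def by (rule clinear_tensor_lift) (simp add: tensor_linear)
  then show ?thesis
    using antilinear_tensor_antimap[OF antilinear_star antilinear_star]
    by (simp add: tensor_dagger_def antilinear_def clinear_iff)
qed

text \<open>The map under \<open>tensor_lift\<close> on the right is bilinear, since \<open>A\<close> and \<open>st\<close> are both antilinear;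
  for a map that is not bilinear, \<open>tensor_lift\<close> is unspecified.\<close>

lemma antilinear_tensor_lift:
  assumes A: "antilinear A" and f: "cbilinear f"
  shows "A (tensor_lift f t) = tensor_lift (\<lambda>x y. A (f (st y) (st x))) (tensor_dagger st t)"
proof -
  have b: "cbilinear (\<lambda>x y. A (f (st y) (st x)))"
    using A f antilinear_star by (simp add: cbilinear_def clinear_iff antilinear_def)
  show ?thesis
    by (rule antilinear_tensor_eqI[where t = t])
      (use A clinear_tensor_lift[OF f] clinear_tensor_lift[OF b] antilinear_dagger in
        \<open>simp_all add: antilinear_def clinear_iff tensor_lift_pure[OF f] tensor_lift_pure[OF b]
          tensor_dagger_pure[OF antilinear_star] star_star\<close>)
qed

end

context flip_hopf_star_algebra
begin

text \<open>Since \<Delta> intertwines the involution with the dagger, an antilinear map turns a sum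
  over h into one over \<open>st h\<close> with the legs starred and exchanged.\<close>

lemma antilinear_sweedler:
  assumes "antilinear A" "cbilinear f"
  shows "A (sweedler h f) = sweedler (st h) (\<lambda>x y. A (f (st y) (st x)))"
  using antilinear_tensor_lift[OF assms] by (simp add: comult_star)

lemma unimodular_hopf_algebra_of_star:
  assumes I: "right_invariant_integral u \<Delta> I" and \<Lambda>: "left_integral_element m \<epsilon> \<Lambda>"
    and "I \<Lambda> = 1" and I_star: "\<And>h. I (st h) = cnj (I h)" and \<Lambda>_star: "st \<Lambda> = \<Lambda>"
  shows "unimodular_hopf_algebra m u \<Delta> \<epsilon> S I \<Lambda>"
proof (intro unimodular_hopf_algebra.intro hopf_algebra_axioms unimodular_hopf_algebra_axioms.intro)
  fix h
  show lin: "clinear I" and inv: "sweedler h (\<lambda>x y. I x *\<^sub>C y) = I h *\<^sub>C u" for h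
    using I by (auto simp: right_invariant_integral_def)
  have "cbilinear (\<lambda>x y. I x *\<^sub>C y)"
    using clinear_comp[OF lin clinear_id] by (simp add: tensor_linear)
  \<comment> \<open>Starring right invariance at \<open>st h\<close> exchanges the legs, which
    yields left invariance at h.\<close>
  from antilinear_sweedler[OF antilinear_star this, of "st h"]
  show "sweedler h (\<lambda>x y. I y *\<^sub>C x) = I h *\<^sub>C u"
    by (simp add: inv star_scaleC star_unit star_star I_star)
  show left: "m h \<Lambda> = \<epsilon> h *\<^sub>C \<Lambda>" for h
    using \<Lambda> by (simp add: left_integral_element_def)
  have "m \<Lambda> h = st (m (st h) \<Lambda>)"
    by (simp add: star_mult star_star \<Lambda>_star)
  then show "m \<Lambda> h = \<epsilon> h *\<^sub>C \<Lambda>"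
    by (simp add: left star_scaleC \<Lambda>_star counit_star star_star)
qed (fact assms)

end

section \<open>Compatibility of the induced operations with the involution\<close>

locale unimodular_hopf_star_algebra =
  unimodular_hopf_algebra m u \<Delta> \<epsilon> S I \<Lambda> + flip_hopf_star_algebra m u \<Delta> \<epsilon> S st
  for m :: "'a::complex_vector \<Rightarrow> 'a \<Rightarrow> 'a" and u and \<Delta> and \<epsilon> and S and I and \<Lambda> and st +
  assumes integral_star: "I (st h) = cnj (I h)"
    and integral_element_star: "st \<Lambda> = \<Lambda>"
begin

text \<open>As \<Lambda> is self-adjoint, the dagger carries the first form of
  \<open>dcomult\<close> at h to the fourth at \<open>st h\<close>.\<close>

lemma dcomult_star: "dcomult (st h) = tensor_dagger st (dcomult h)"
proof -
  have "tensor_dagger st (dcomult h) = sweedler \<Lambda> (\<lambda>x y. m (st h) (S x) \<otimes>\<^sub>t y)"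
    unfolding dcomult_eq(1)
    by (subst antilinear_sweedler)
      (simp_all add: antilinear_dagger linear integral_element_star tensor_dagger_pure
        antilinear_star star_star star_mult antipode_star)
  then show ?thesis by (simp add: dcomult_eq(4))
qed

text \<open>The involution carries the first form of \<open>dmult\<close> to the second with the
  arguments exchanged, up to the position of S, which \<open>form_eq\<close> corrects.\<close>

lemma dmult_star: "st (dmult h k) = dmult (st k) (st h)"
proof -
  have I: "cnj (I (m (S (st x)) k)) = I (m (st k) (S x))" for x
    by (simp add: integral_star[symmetric] star_mult antipode_star star_star)
  have "st (dmult h k) = sweedler (st h) (\<lambda>x y. I (m (st k) (S x)) *\<^sub>C y)"
    unfolding dmult_eq(1)
    by (subst antilinear_sweedler)
      (simp_all add: antilinear_star linear star_scaleC star_star I)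
  then show ?thesis by (simp add: dmult_eq(2) form_eq)
qed

lemma star_algebra_dmult: "star_algebra dmult \<Lambda> st"
  by (intro star_algebra.intro unital_algebra_dmult star_algebra_axioms.intro antilinear_star
    star_star dmult_star)

lemma F_star_algebra_dcomult: "F_star_algebra m u dcomult I st"
  by (intro F_star_algebra.intro F_algebra_dcomult star_algebra_axioms F_star_algebra_axioms.intro)
    (simp_all add: dcomult_star integral_star[symmetric] star_mult)

lemma F_star_algebra_dmult: "F_star_algebra dmult \<Lambda> \<Delta> \<epsilon> st"
  by (intro F_star_algebra.intro F_algebra_dmult star_algebra_dmult F_star_algebra_axioms.intro)
    (simp_all add: comult_star counit_star dmult_star)

lemma antipode_inverse_star: "antipode_inverse (st h) = st (antipode_inverse h)"
  by (metis antipode_antipode_inverse antipode_inverse_antipode antipode_star)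

lemma flip_hopf_star_algebra_dual: "flip_hopf_star_algebra dmult \<Lambda> dcomult I antipode_inverse st"
  by (intro flip_hopf_star_algebra.intro hopf_algebra_dual star_algebra_dmult
    flip_hopf_star_algebra_axioms.intro dcomult_star antipode_inverse_star)
    (simp add: integral_star)

end

theorem corollary3p3:
  fixes mu_r :: "'h::complex_vector \<Rightarrow> 'h \<Rightarrow> 'h" and one_r :: 'h
    and Delta_g :: "'h \<Rightarrow> ('h, 'h) tensor" and eps_g :: "'h \<Rightarrow> complex"
    and S :: "'h \<Rightarrow> 'h" and star :: "'h \<Rightarrow> 'h"
    and I :: "'h \<Rightarrow> complex" and \<Lambda> :: 'h
  assumes finite_dim: "\<exists>B :: 'h set. finite B \<and> complex_vector.span B = UNIV"
    and hopf: "flip_hopf_star_algebra mu_r one_r Delta_g eps_g S star"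
    and integral: "right_invariant_integral one_r Delta_g I"
    and integral_element: "left_integral_element mu_r eps_g \<Lambda>"
    and normalised: "I \<Lambda> = 1"
    and integral_star: "\<forall>h. I (star h) = cnj (I h)"
    and element_star: "star \<Lambda> = \<Lambda>"
  shows "F_star_algebra mu_r one_r (induced_comult mu_r Delta_g S \<Lambda>) I star \<and>
    F_star_algebra (induced_mult mu_r Delta_g S I) \<Lambda> Delta_g eps_g star \<and>
    (\<exists>S'. flip_hopf_star_algebra (induced_mult mu_r Delta_g S I) \<Lambda>
           (induced_comult mu_r Delta_g S \<Lambda>) I S' star)"
proof -
  interpret H: flip_hopf_star_algebra mu_r one_r Delta_g eps_g S star by (rule hopf)
  interpret unimodular_hopf_algebra mu_r one_r Delta_g eps_g S I \<Lambda>
    using integral integral_element normalised integral_star element_star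
    by (intro H.unimodular_hopf_algebra_of_star) auto
  interpret unimodular_hopf_star_algebra mu_r one_r Delta_g eps_g S I \<Lambda> star
    using integral_star element_star by unfold_locales auto
  \<comment> \<open>The witness for \<open>S'\<close> is \<open>antipode_inverse\<close>.\<close>
  show ?thesis
    using F_star_algebra_dcomult F_star_algebra_dmult flip_hopf_star_algebra_dual by blast
qed

end
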